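(* Let $\alpha,\beta,\gamma\in\mathbb{R}$, and let $(G_3,g,J)$ be the connected three-dimensional unimodular Lie group with left-invariant Lorentzian metric $g$ whose Lie algebra has a pseudo-orthonormal basis $\{e_1,e_2,e_3\}$, $e_3$ timelike, with $$[e_1,e_2]=-\gamma e_3,\quad [e_1,e_3]=-\beta e_2,\quad [e_2,e_3]=\alpha e_1,$$ and with the product structure $J$ given by $Je_1=e_1$, $Je_2=e_2$, $Je_3=-e_3$. Then $(G_3,g,J)$ admits left-invariant Ricci collineations associated to the Kobayashi-Nomizu connection $\nabla^1$ if and only if one of the following holds, and in each case the space $\mathbb{V}_{\mathbb{RC}}$ of these collineations is as indicated: (1) $\alpha\beta\gamma=0$, with $\mathbb{V}_{\mathbb{RC}}=\langle e_1,e_2,e_3\rangle$; (2) $\alpha\beta\gamma\neq0$, with $\mathbb{V}_{\mathbb{RC}}=\langle e_3\rangle$.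
   Context: Pseudo-orthonormal with $e_3$ timelike means $g(e_1,e_1)=g(e_2,e_2)=1$, $g(e_3,e_3)=-1$, $g(e_i,e_j)=0$ for $i\ne j$. $J$ is extended left-invariantly to a $(1,1)$-tensor with $J^2=\mathrm{id}$. Let $\nabla$ be the Levi-Civita connection of $g$. The canonical connection is $\nabla^0_XY=\nabla_XY-\frac12(\nabla_XJ)JY$, and the Kobayashi-Nomizu connection is $$\nabla^1_XY=\nabla^0_XY-\tfrac14\big[(\nabla_YJ)JX-(\nabla_{JY}J)X\big],$$ with curvature $R^1(X,Y)Z=\nabla^1_X\nabla^1_YZ-\nabla^1_Y\nabla^1_XZ-\nabla^1_{[X,Y]}Z$. Its Ricci tensor is $$\mathrm{Ric}^1(X,Y)=-g(R^1(X,e_1)Y,e_1)-g(R^1(X,e_2)Y,e_2)+g(R^1(X,e_3)Y,e_3),$$ and its symmetrization is $\widetilde{\mathrm{Ric}}^1(X,Y)=\frac12\big(\mathrm{Ric}^1(X,Y)+\mathrm{Ric}^1(Y,X)\big)$. For a left-invariant vector field $\xi=\lambda_1e_1+\lambda_2e_2+\lambda_3e_3$ ($\lambda_i\in\mathbb{R}$), $$(L_\xi\widetilde{\mathrm{Ric}}^1)(X,Y)=\xi\big(\widetilde{\mathrm{Ric}}^1(X,Y)\big)-\widetilde{\mathrm{Ric}}^1([\xi,X],Y)-\widetilde{\mathrm{Ric}}^1(X,[\xi,Y]).$$ A left-invariant Ricci collineation associated to $\nabla^1$ is a left-invariant $\xi$ with $L_\xi\widetilde{\mathrm{Ric}}^1=0$;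 $\mathbb{V}_{\mathbb{RC}}$ denotes the real vector space of all of them, and $\langle\cdot\rangle$ denotes linear span. The group admits left-invariant Ricci collineations if there is a nonzero such $\xi$. *)

theory Defs
  imports "HOL-Analysis.Analysis" "HOL-Library.Function_Algebras"
begin

text \<open>
  Tangent vectors and vector fields are represented as (families of) functionals, so that
  pointwise operations on functions make them real vector spaces.
\<close>

instantiation "fun" :: (type, real_vector) real_vector
begin

definition scaleR_fun :: "real \<Rightarrow> ('a \<Rightarrow> 'b) \<Rightarrow> 'a \<Rightarrow> 'b"
  where "scaleR_fun c f = (\<lambda>x. c *\<^sub>R f x)"

instance
  by standard (auto simp: scaleR_fun_def plus_fun_def scaleR_add_right scaleR_add_left)

end


section \<open>Smooth manifolds\<close>

text \<open>Intended for open \<open>S\<close> only.\<close>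

primrec Ck_on :: "nat \<Rightarrow> 'a::real_normed_vector set \<Rightarrow> ('a \<Rightarrow> 'b::real_normed_vector) \<Rightarrow> bool"
  where
    "Ck_on 0 S f \<longleftrightarrow> continuous_on S f"
  | "Ck_on (Suc k) S f \<longleftrightarrow>
      (\<forall>x\<in>S. f differentiable (at x)) \<and>
      (\<forall>v. Ck_on k S (\<lambda>x. frechet_derivative f (at x) v))"

definition smooth_on :: "'a::real_normed_vector set \<Rightarrow> ('a \<Rightarrow> 'b::real_normed_vector) \<Rightarrow> bool"
  where "smooth_on S f \<longleftrightarrow> (\<forall>k. Ck_on k S f)"

text \<open>A chart \<open>(U, \<phi>)\<close> has inverse \<open>inv_into U \<phi>\<close>. Atlases are not required to be maximal.\<close>

type_synonym ('g, 'n) chart = "'g set \<times> ('g \<Rightarrow> real ^ 'n)"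

definition smooth_atlas :: "('g::topological_space, 'n::finite) chart set \<Rightarrow> bool"
  where "smooth_atlas A \<longleftrightarrow>
    (\<forall>(U, \<phi>)\<in>A. open U \<and> open (\<phi> ` U) \<and> homeomorphism U (\<phi> ` U) \<phi> (inv_into U \<phi>)) \<and>
    (\<Union>(U, \<phi>)\<in>A. U) = UNIV \<and>
    (\<forall>(U, \<phi>)\<in>A. \<forall>(V, \<psi>)\<in>A. smooth_on (\<phi> ` (U \<inter> V)) (\<psi> \<circ> inv_into U \<phi>))"

definition smooth_fun :: "('g, 'n::finite) chart set \<Rightarrow> ('g \<Rightarrow> real) \<Rightarrow> bool"
  where "smooth_fun A f \<longleftrightarrow> (\<forall>(U, \<phi>)\<in>A. smooth_on (\<phi> ` U) (f \<circ> inv_into U \<phi>))"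

text \<open>
  A tangent vector at \<open>p\<close> is a directional derivative, in some chart around \<open>p\<close>, acting on
  globally defined smooth functions. To make the representing functional unique, it is set to
  \<open>0\<close> on functions that are not smooth.
\<close>

type_synonym 'g tvec = "('g \<Rightarrow> real) \<Rightarrow> real"

definition tangent_space :: "('g, 'n::finite) chart set \<Rightarrow> 'g \<Rightarrow> 'g tvec set"
  where "tangent_space A p =
    {v. \<exists>(U, \<phi>)\<in>A. p \<in> U \<and> (\<exists>w. v = (\<lambda>f.
      if smooth_fun A f then frechet_derivative (f \<circ> inv_into U \<phi>) (at (\<phi> p)) w else 0))}"

definition pushforward :: "('g \<Rightarrow> 'g) \<Rightarrow> 'g tvec \<Rightarrow> 'g tvec"
  where "pushforward h v = (\<lambda>f. v (f \<circ> h))"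

type_synonym 'g vfield = "'g \<Rightarrow> 'g tvec"

definition vector_field :: "('g, 'n::finite) chart set \<Rightarrow> 'g vfield \<Rightarrow> bool"
  where "vector_field A X \<longleftrightarrow>
    (\<forall>p. X p \<in> tangent_space A p) \<and>
    (\<forall>f. smooth_fun A f \<longrightarrow> smooth_fun A (\<lambda>p. X p f))"

definition vf_apply :: "'g vfield \<Rightarrow> ('g \<Rightarrow> real) \<Rightarrow> 'g \<Rightarrow> real"
  where "vf_apply X f = (\<lambda>p. X p f)"

definition vf_scale :: "('g \<Rightarrow> real) \<Rightarrow> 'g vfield \<Rightarrow> 'g vfield"
  where "vf_scale f X = (\<lambda>p. f p *\<^sub>R X p)"

definition vf_bracket :: "'g vfield \<Rightarrow> 'g vfield \<Rightarrow> 'g vfield"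
  where "vf_bracket X Y = (\<lambda>p f. X p (vf_apply Y f) - Y p (vf_apply X f))"


section \<open>Lie groups\<close>

definition lie_group ::
    "('g \<Rightarrow> 'g \<Rightarrow> 'g) \<Rightarrow> 'g \<Rightarrow> ('g \<Rightarrow> 'g) \<Rightarrow>
     ('g::{t2_space, second_countable_topology}, 'n::finite) chart set \<Rightarrow> bool"
  where "lie_group mul one invs A \<longleftrightarrow>
    Groups.group mul one invs \<and> smooth_atlas A \<and>
    continuous_on UNIV (\<lambda>(x, y). mul x y) \<and> continuous_on UNIV invs \<and>
    (\<forall>(U, \<phi>)\<in>A. \<forall>(V, \<psi>)\<in>A. \<forall>(W, \<theta>)\<in>A.
      smooth_on
        {(x, y). x \<in> \<phi> ` U \<and> y \<in> \<psi> ` V \<and> mul (inv_into U \<phi> x) (inv_into V \<psi> y) \<in> W}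
        (\<lambda>(x, y). \<theta> (mul (inv_into U \<phi> x) (inv_into V \<psi> y)))) \<and>
    (\<forall>(U, \<phi>)\<in>A. \<forall>(V, \<psi>)\<in>A.
      smooth_on {x. x \<in> \<phi> ` U \<and> invs (inv_into U \<phi> x) \<in> V}
        (\<lambda>x. \<psi> (invs (inv_into U \<phi> x))))"

text \<open>
  On a second countable Lie group, Borel measures that are finite on compact sets are Radon, so no
  regularity condition is needed below.
\<close>

definition left_haar_measure ::
    "('g \<Rightarrow> 'g \<Rightarrow> 'g) \<Rightarrow> ('g::topological_space) measure \<Rightarrow> bool"
  where "left_haar_measure mul M \<longleftrightarrow>
    sets M = sets borel \<and> emeasure M UNIV \<noteq> 0 \<and>
    (\<forall>K. compact K \<longrightarrow> emeasure M K < \<infinity>) \<and>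
    (\<forall>a. distr M borel (\<lambda>x. mul a x) = M)"

definition unimodular :: "('g \<Rightarrow> 'g::topological_space \<Rightarrow> 'g) \<Rightarrow> bool"
  where "unimodular mul \<longleftrightarrow>
    (\<forall>M. left_haar_measure mul M \<longrightarrow> (\<forall>a. distr M borel (\<lambda>x. mul x a) = M))"

definition left_invariant_vf :: "('g \<Rightarrow> 'g \<Rightarrow> 'g) \<Rightarrow> 'g vfield \<Rightarrow> bool"
  where "left_invariant_vf mul X \<longleftrightarrow>
    (\<forall>a p. X (mul a p) = pushforward (mul a) (X p))"

definition lie_algebra :: "('g \<Rightarrow> 'g \<Rightarrow> 'g) \<Rightarrow> ('g, 'n::finite) chart set \<Rightarrow> 'g vfield set"
  where "lie_algebra mul A = {X. vector_field A X \<and> left_invariant_vf mul X}"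


section \<open>Lorentzian metrics and (1,1)-tensors\<close>

text \<open>Only the values on tangent spaces are constrained.\<close>

type_synonym 'g bilinear_field = "'g \<Rightarrow> 'g tvec \<Rightarrow> 'g tvec \<Rightarrow> real"
type_synonym 'g tensor11 = "'g \<Rightarrow> 'g tvec \<Rightarrow> 'g tvec"

definition metric_vf :: "'g bilinear_field \<Rightarrow> 'g vfield \<Rightarrow> 'g vfield \<Rightarrow> 'g \<Rightarrow> real"
  where "metric_vf g X Y = (\<lambda>p. g p (X p) (Y p))"

definition tensor_vf :: "'g tensor11 \<Rightarrow> 'g vfield \<Rightarrow> 'g vfield"
  where "tensor_vf J X = (\<lambda>p. J p (X p))"

definition lorentzian_metric :: "('g, 'n::finite) chart set \<Rightarrow> 'g bilinear_field \<Rightarrow> bool"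
  where "lorentzian_metric A g \<longleftrightarrow>
    (\<forall>p. \<forall>u\<in>tangent_space A p. \<forall>v\<in>tangent_space A p.
      g p u v = g p v u \<and>
      (\<forall>c. g p (c *\<^sub>R u) v = c * g p u v) \<and>
      (\<forall>w\<in>tangent_space A p. g p (u + w) v = g p u v + g p w v)) \<and>
    (\<forall>p. \<exists>B t. independent B \<and> span B = tangent_space A p \<and>
      t \<in> B \<and> g p t t = -1 \<and> (\<forall>b\<in>B - {t}. g p b b = 1) \<and>
      (\<forall>b\<in>B. \<forall>c\<in>B. b \<noteq> c \<longrightarrow> g p b c = 0)) \<and>
    (\<forall>X Y. vector_field A X \<longrightarrow> vector_field A Y \<longrightarrow> smooth_fun A (metric_vf g X Y))"

definition left_invariant_metric ::
    "('g \<Rightarrow> 'g \<Rightarrow> 'g) \<Rightarrow> ('g, 'n::finite) chart set \<Rightarrow> 'g bilinear_field \<Rightarrow> bool"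
  where "left_invariant_metric mul A g \<longleftrightarrow>
    (\<forall>a p. \<forall>u\<in>tangent_space A p. \<forall>v\<in>tangent_space A p.
      g (mul a p) (pushforward (mul a) u) (pushforward (mul a) v) = g p u v)"

definition product_structure :: "('g, 'n::finite) chart set \<Rightarrow> 'g tensor11 \<Rightarrow> bool"
  where "product_structure A J \<longleftrightarrow>
    (\<forall>p. \<forall>u\<in>tangent_space A p.
      J p u \<in> tangent_space A p \<and> J p (J p u) = u \<and>
      (\<forall>c. J p (c *\<^sub>R u) = c *\<^sub>R J p u) \<and>
      (\<forall>v\<in>tangent_space A p. J p (u + v) = J p u + J p v)) \<and>
    (\<forall>X. vector_field A X \<longrightarrow> vector_field A (tensor_vf J X))"

definition left_invariant_tensor11 ::
    "('g \<Rightarrow> 'g \<Rightarrow> 'g) \<Rightarrow> ('g, 'n::finite) chart set \<Rightarrow> 'g tensor11 \<Rightarrow> bool"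
  where "left_invariant_tensor11 mul A J \<longleftrightarrow>
    (\<forall>a p. \<forall>u\<in>tangent_space A p.
      J (mul a p) (pushforward (mul a) u) = pushforward (mul a) (J p u))"

definition pseudo_orthonormal ::
    "'g bilinear_field \<Rightarrow> 'g vfield \<Rightarrow> 'g vfield \<Rightarrow> 'g vfield \<Rightarrow> bool"
  where "pseudo_orthonormal g e1 e2 e3 \<longleftrightarrow> (\<forall>p.
    g p (e1 p) (e1 p) = 1 \<and> g p (e2 p) (e2 p) = 1 \<and> g p (e3 p) (e3 p) = -1 \<and>
    g p (e1 p) (e2 p) = 0 \<and> g p (e1 p) (e3 p) = 0 \<and> g p (e2 p) (e3 p) = 0)"


section \<open>Connections\<close>

type_synonym 'g connection = "'g vfield \<Rightarrow> 'g vfield \<Rightarrow> 'g vfield"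

definition affine_connection :: "('g, 'n::finite) chart set \<Rightarrow> 'g connection \<Rightarrow> bool"
  where "affine_connection A nabla \<longleftrightarrow>
    (\<forall>X Y. vector_field A X \<longrightarrow> vector_field A Y \<longrightarrow>
      vector_field A (nabla X Y) \<and>
      (\<forall>Z. vector_field A Z \<longrightarrow>
        nabla (X + Z) Y = nabla X Y + nabla Z Y \<and>
        nabla X (Y + Z) = nabla X Y + nabla X Z) \<and>
      (\<forall>f. smooth_fun A f \<longrightarrow>
        nabla (vf_scale f X) Y = vf_scale f (nabla X Y) \<and>
        nabla X (vf_scale f Y) = vf_scale (vf_apply X f) Y + vf_scale f (nabla X Y)))"

definition levi_civita ::
    "('g, 'n::finite) chart set \<Rightarrow> 'g bilinear_field \<Rightarrow> 'g connection \<Rightarrow> bool"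
  where "levi_civita A g nabla \<longleftrightarrow>
    affine_connection A nabla \<and>
    (\<forall>X Y. vector_field A X \<longrightarrow> vector_field A Y \<longrightarrow>
      nabla X Y - nabla Y X = vf_bracket X Y) \<and>
    (\<forall>X Y Z. vector_field A X \<longrightarrow> vector_field A Y \<longrightarrow> vector_field A Z \<longrightarrow>
      vf_apply X (metric_vf g Y Z) = metric_vf g (nabla X Y) Z + metric_vf g Y (nabla X Z))"

definition cov_deriv_tensor :: "'g connection \<Rightarrow> 'g tensor11 \<Rightarrow> 'g vfield \<Rightarrow> 'g vfield \<Rightarrow> 'g vfield"
  where "cov_deriv_tensor nabla J X Y = nabla X (tensor_vf J Y) - tensor_vf J (nabla X Y)"

definition canonical_connection :: "'g connection \<Rightarrow> 'g tensor11 \<Rightarrow> 'g connection"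
  where "canonical_connection nabla J X Y =
    nabla X Y - (1/2) *\<^sub>R cov_deriv_tensor nabla J X (tensor_vf J Y)"

definition kobayashi_nomizu :: "'g connection \<Rightarrow> 'g tensor11 \<Rightarrow> 'g connection"
  where "kobayashi_nomizu nabla J X Y =
    canonical_connection nabla J X Y -
    (1/4) *\<^sub>R (cov_deriv_tensor nabla J Y (tensor_vf J X) -
               cov_deriv_tensor nabla J (tensor_vf J Y) X)"

definition curvature :: "'g connection \<Rightarrow> 'g vfield \<Rightarrow> 'g vfield \<Rightarrow> 'g vfield \<Rightarrow> 'g vfield"
  where "curvature nabla X Y Z =
    nabla X (nabla Y Z) - nabla Y (nabla X Z) - nabla (vf_bracket X Y) Z"


section \<open>Ricci tensors and Ricci collineations\<close>

text \<open>Here \<open>e1, e2, e3\<close> is a pseudo-orthonormal frame with \<open>e3\<close> timelike.\<close>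

definition ricci ::
    "'g bilinear_field \<Rightarrow> 'g vfield \<Rightarrow> 'g vfield \<Rightarrow> 'g vfield \<Rightarrow> 'g connection \<Rightarrow>
     'g vfield \<Rightarrow> 'g vfield \<Rightarrow> 'g \<Rightarrow> real"
  where "ricci g e1 e2 e3 nabla X Y =
    - metric_vf g (curvature nabla X e1 Y) e1
    - metric_vf g (curvature nabla X e2 Y) e2
    + metric_vf g (curvature nabla X e3 Y) e3"

definition ricci_sym ::
    "'g bilinear_field \<Rightarrow> 'g vfield \<Rightarrow> 'g vfield \<Rightarrow> 'g vfield \<Rightarrow> 'g connection \<Rightarrow>
     'g vfield \<Rightarrow> 'g vfield \<Rightarrow> 'g \<Rightarrow> real"
  where "ricci_sym g e1 e2 e3 nabla X Y =
    (1/2) *\<^sub>R (ricci g e1 e2 e3 nabla X Y + ricci g e1 e2 e3 nabla Y X)"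

definition lie_derivative ::
    "'g vfield \<Rightarrow> ('g vfield \<Rightarrow> 'g vfield \<Rightarrow> 'g \<Rightarrow> real) \<Rightarrow>
     'g vfield \<Rightarrow> 'g vfield \<Rightarrow> 'g \<Rightarrow> real"
  where "lie_derivative \<xi> T X Y =
    vf_apply \<xi> (T X Y) - T (vf_bracket \<xi> X) Y - T X (vf_bracket \<xi> Y)"

definition ricci_collineations ::
    "('g \<Rightarrow> 'g \<Rightarrow> 'g) \<Rightarrow> ('g, 'n::finite) chart set \<Rightarrow> 'g bilinear_field \<Rightarrow>
     'g vfield \<Rightarrow> 'g vfield \<Rightarrow> 'g vfield \<Rightarrow> 'g connection \<Rightarrow> 'g vfield set"
  where "ricci_collineations mul A g e1 e2 e3 nabla =
    {\<xi> \<in> lie_algebra mul A. \<forall>X Y. vector_field A X \<longrightarrow> vector_field A Y \<longrightarrow>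
      lie_derivative \<xi> (ricci_sym g e1 e2 e3 nabla) X Y = 0}"

end

theory Submission
  imports Defs
begin

text \<open>
  Since \<open>g\<close> has rank 3, the frame \<open>e1, e2, e3\<close> spans every tangent space, so a tensor field vanishes
  as soon as it vanishes on the frame. On the frame the Koszul formula has constant right-hand sides
  and gives \<open>\<nabla>\<close>, from which the only nonzero values of \<open>\<nabla>\<^sup>1\<close> are \<open>\<nabla>\<^sup>1 e3 e1 = \<beta> e2\<close> and
  \<open>\<nabla>\<^sup>1 e3 e2 = - \<alpha> e1\<close>. Hence the symmetrized Ricci tensor is diagonal with entries
  \<open>- \<beta>\<gamma>, - \<alpha>\<gamma>, 0\<close>, and for \<open>\<xi> = a e1 + b e2 + c e3\<close> the only components of its Lie derivative that can
  be nonzero are \<open>(e1, e3) \<mapsto> \<alpha>\<beta>\<gamma> b\<close> and \<open>(e2, e3) \<mapsto> - \<alpha>\<beta>\<gamma> a\<close>, up to symmetry.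
\<close>

lemma scaleR_fun_apply [simp]: "(c *\<^sub>R f) x = c *\<^sub>R f x"
  by (simp add: scaleR_fun_def)

section \<open>Functions of class \<open>C\<^sup>k\<close>\<close>

text \<open>\<open>Ck_on\<close> differentiates at points and not within \<open>S\<close>; openness
  is what lets the values on \<open>S\<close> determine these derivatives.\<close>

lemma Ck_on_cong:
  assumes "open S" "\<And>x. x \<in> S \<Longrightarrow> f x = g x"
  shows "Ck_on k S f \<longleftrightarrow> Ck_on k S g"
  using assms
proof (induction k arbitrary: f g)
  case 0
  then show ?case by (auto intro!: continuous_on_cong)
next
  case (Suc k)
  have imp: "f' differentiable at x"
    if "x \<in> S" "\<And>y. y \<in> S \<Longrightarrow> f' y = g' y" "g' differentiable at x" for x and f' g' :: "'a \<Rightarrow> 'b"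
    using that Suc.prems(1) unfolding differentiable_def
    by (metis has_derivative_transform_within_open)
  have d: "f differentiable at x \<longleftrightarrow> g differentiable at x" if "x \<in> S" for x
    using imp[of x f g] imp[of x g f] that Suc.prems(2) by auto
  have "Ck_on k S (\<lambda>x. frechet_derivative f (at x) v) \<longleftrightarrow>
        Ck_on k S (\<lambda>x. frechet_derivative g (at x) v)" if "\<forall>x\<in>S. f differentiable at x" for v
    using that Suc.prems by (intro Suc.IH) (auto intro!: fun_cong[OF frechet_derivative_transform_within_open])
  with d show ?case by auto
qed

lemma Ck_on_Suc_imp: "Ck_on (Suc k) S f \<Longrightarrow> Ck_on k S f"
proof (induction k arbitrary: f)
  case 0
  then show ?case
    by (auto simp: continuous_on_eq_continuous_within intro!: differentiable_imp_continuous_within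
        intro: differentiable_at_withinI)
next
  case (Suc k)
  then show ?case by (metis Ck_on.simps(2))
qed

lemma Ck_on_const: "Ck_on k S (\<lambda>x. c)"
  by (induction k arbitrary: c) auto

lemma frechet_derivative_add_at:
  assumes "f differentiable at x" "g differentiable at x"
  shows "frechet_derivative (\<lambda>x. f x + g x) (at x) v
      = frechet_derivative f (at x) v + frechet_derivative g (at x) v"
  using has_derivative_add[OF assms[unfolded frechet_derivative_works]]
  by (metis frechet_derivative_at)

lemma Ck_on_add:
  assumes "open S" "Ck_on k S f" "Ck_on k S g"
  shows "Ck_on k S (\<lambda>x. f x + g x)"
  using assms
proof (induction k arbitrary: f g)
  case 0
  then show ?case by (auto intro: continuous_on_add)
next
  case (Suc k)
  have "Ck_on k S (\<lambda>x. frechet_derivative (\<lambda>x. f x + g x) (at x) v)" for v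
  proof -
    have "Ck_on k S (\<lambda>x. frechet_derivative f (at x) v + frechet_derivative g (at x) v)"
      using Suc.prems by (intro Suc.IH) auto
    then show ?thesis
      using Suc.prems by (subst Ck_on_cong) (auto simp: frechet_derivative_add_at)
  qed
  with Suc.prems show ?case by auto
qed

lemma frechet_derivative_mult_at:
  fixes f g :: "'a::real_normed_vector \<Rightarrow> real"
  assumes "f differentiable at x" "g differentiable at x"
  shows "frechet_derivative (\<lambda>x. f x * g x) (at x) v
      = f x * frechet_derivative g (at x) v + frechet_derivative f (at x) v * g x"
  using has_derivative_mult[OF assms[unfolded frechet_derivative_works]]
  by (metis frechet_derivative_at)

lemma Ck_on_mult:
  fixes f g :: "'a::real_normed_vector \<Rightarrow> real"
  assumes "open S" "Ck_on k S f" "Ck_on k S g"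
  shows "Ck_on k S (\<lambda>x. f x * g x)"
  using assms
proof (induction k arbitrary: f g)
  case 0
  then show ?case by (auto intro: continuous_on_mult)
next
  case (Suc k)
  have "Ck_on k S (\<lambda>x. frechet_derivative (\<lambda>x. f x * g x) (at x) v)" for v
  proof -
    \<comment> \<open>The product rule leaves one factor undifferentiated; it is of class
      \<open>Suc k\<close> and has to be lowered to \<open>k\<close> before the induction hypothesis
      applies.\<close>
    have "Ck_on k S (\<lambda>x. f x * frechet_derivative g (at x) v + frechet_derivative f (at x) v * g x)"
      using Suc.prems Ck_on_Suc_imp by (intro Ck_on_add Suc.IH) auto
    then show ?thesis
      using Suc.prems by (subst Ck_on_cong) (auto simp: frechet_derivative_mult_at)
  qed
  with Suc.prems show ?case by (auto intro: differentiable_mult)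
qed

lemma smooth_on_const: "smooth_on S (\<lambda>x. c)"
  by (simp add: smooth_on_def Ck_on_const)

lemma smooth_on_add: "open S \<Longrightarrow> smooth_on S f \<Longrightarrow> smooth_on S g \<Longrightarrow> smooth_on S (\<lambda>x. f x + g x)"
  by (simp add: smooth_on_def Ck_on_add)

lemma smooth_on_mult:
  fixes f g :: "'a::real_normed_vector \<Rightarrow> real"
  shows "open S \<Longrightarrow> smooth_on S f \<Longrightarrow> smooth_on S g \<Longrightarrow> smooth_on S (\<lambda>x. f x * g x)"
  by (simp add: smooth_on_def Ck_on_mult)

lemma smooth_on_imp_differentiable: "smooth_on S f \<Longrightarrow> x \<in> S \<Longrightarrow> f differentiable at x"
  by (metis Ck_on.simps(2) smooth_on_def)

section \<open>Tangent vectors\<close>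

locale smooth_manifold =
  fixes A :: "('g::topological_space, 'n::finite) chart set"
  assumes atlas: "smooth_atlas A"
begin

lemma chartD:
  assumes "(U, \<phi>) \<in> A"
  shows "open U" "open (\<phi> ` U)" "homeomorphism U (\<phi> ` U) \<phi> (inv_into U \<phi>)"
  using atlas assms unfolding smooth_atlas_def by auto

lemma chart_inv: "(U, \<phi>) \<in> A \<Longrightarrow> p \<in> U \<Longrightarrow> inv_into U \<phi> (\<phi> p) = p"
  using chartD(3) homeomorphism_apply1 by blast

lemma chart_exists: obtains U \<phi> where "(U, \<phi>) \<in> A" "p \<in> U"
  using atlas unfolding smooth_atlas_def by blast

lemma open_chart_image:
  assumes "(U, \<phi>) \<in> A" "open W"
  shows "open (\<phi> ` (U \<inter> W))"
  using homeomorphism_imp_open_map[OF chartD(3)[OF assms(1)], of "U \<inter> W"] chartD(2)[OF assms(1)] assms(2)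
  by (metis openin_open_Int openin_open_eq)

lemma smooth_fun_const [simp]: "smooth_fun A (\<lambda>p. c)"
  unfolding smooth_fun_def by (auto simp: o_def smooth_on_const)

lemma smooth_fun_add [intro, simp]:
  "smooth_fun A f \<Longrightarrow> smooth_fun A h \<Longrightarrow> smooth_fun A (\<lambda>p. f p + h p)"
  unfolding smooth_fun_def o_def by (fast intro: smooth_on_add chartD(2))

lemma smooth_fun_mult [intro, simp]:
  "smooth_fun A f \<Longrightarrow> smooth_fun A h \<Longrightarrow> smooth_fun A (\<lambda>p. f p * h p)"
  unfolding smooth_fun_def o_def by (fast intro: smooth_on_mult chartD(2))

lemma smooth_fun_minus [intro, simp]: "smooth_fun A f \<Longrightarrow> smooth_fun A (\<lambda>p. - f p)"
  using smooth_fun_mult[of "\<lambda>p. -1" f] by simp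

lemma smooth_fun_diff [intro, simp]:
  "smooth_fun A f \<Longrightarrow> smooth_fun A h \<Longrightarrow> smooth_fun A (\<lambda>p. f p - h p)"
  using smooth_fun_add[of f "\<lambda>p. - h p"] by simp

lemma smooth_fun_differentiable:
  assumes "(U, \<phi>) \<in> A" "p \<in> U" "smooth_fun A f"
  shows "f \<circ> inv_into U \<phi> differentiable at (\<phi> p)"
  using assms unfolding smooth_fun_def by (blast intro: smooth_on_imp_differentiable)

text \<open>The functional from \<open>tangent_space\<close> with chart and direction made
  parameters: for a fixed chart it is linear in \<open>w\<close>, so dimension arguments
  apply.\<close>

definition chart_deriv :: "'g set \<Rightarrow> ('g \<Rightarrow> real ^ 'n) \<Rightarrow> 'g \<Rightarrow> real ^ 'n \<Rightarrow> 'g tvec"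
  where "chart_deriv U \<phi> p w = (\<lambda>f.
    if smooth_fun A f then frechet_derivative (f \<circ> inv_into U \<phi>) (at (\<phi> p)) w else 0)"

text \<open>Chain rule: the derivative of the transition map carries the direction from one chart to
  the other.\<close>

lemma chart_deriv_change:
  assumes U: "(U, \<phi>) \<in> A" "p \<in> U" and V: "(V, \<psi>) \<in> A" "p \<in> V"
  shows "chart_deriv V \<psi> p w
    = chart_deriv U \<phi> p (frechet_derivative (\<phi> \<circ> inv_into V \<psi>) (at (\<psi> p)) w)"
proof (rule ext)
  fix f
  let ?t = "\<phi> \<circ> inv_into V \<psi>"
  show "chart_deriv V \<psi> p w f
    = chart_deriv U \<phi> p (frechet_derivative (\<phi> \<circ> inv_into V \<psi>) (at (\<psi> p)) w) f"
  proof (cases "smooth_fun A f")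
    case True
    have op: "open (\<psi> ` (V \<inter> U))"
      using open_chart_image V(1) chartD(1)[OF U(1)] by blast
    have tp: "?t (\<psi> p) = \<phi> p"
      by (simp add: chart_inv V)
    have "smooth_on (\<psi> ` (V \<inter> U)) ?t"
      using atlas U(1) V(1) unfolding smooth_atlas_def by blast
    then have dt: "?t differentiable at (\<psi> p)"
      using U V by (blast intro: smooth_on_imp_differentiable)
    have df: "f \<circ> inv_into U \<phi> differentiable at (?t (\<psi> p))"
      using smooth_fun_differentiable[OF U True] tp by simp
    have "frechet_derivative (f \<circ> inv_into V \<psi>) (at (\<psi> p))
        = frechet_derivative ((f \<circ> inv_into U \<phi>) \<circ> ?t) (at (\<psi> p))"
    \<comment> \<open>The two functions agree only on the image of the overlap, where
      \<open>inv_into V \<psi>\<close> lands in \<open>U\<close>; the overlap is open, so this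
      suffices.\<close>
    proof (rule frechet_derivative_transform_within_open[OF _ op])
      show "f \<circ> inv_into V \<psi> differentiable at (\<psi> p)"
        using smooth_fun_differentiable[OF V True] .
    qed (use U V chart_inv in auto)
    also have "\<dots> = frechet_derivative (f \<circ> inv_into U \<phi>) (at (\<phi> p)) \<circ> frechet_derivative ?t (at (\<psi> p))"
      using frechet_derivative_compose[OF dt df] by (simp only: tp)
    finally show ?thesis
      by (simp add: chart_deriv_def)
  qed (simp add: chart_deriv_def)
qed

text \<open>The definition lets the chart vary with the vector. By the change of charts one chart
  around \<open>p\<close> gives them all, which makes the tangent space a linear image.\<close>

lemma tangent_space_chart:
  assumes "(U, \<phi>) \<in> A" "p \<in> U"
  shows "tangent_space A p = range (chart_deriv U \<phi> p)"
proof -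
  have "tangent_space A p = (\<Union>(V, \<psi>)\<in>{(V, \<psi>)\<in>A. p \<in> V}. range (chart_deriv V \<psi> p))"
    unfolding tangent_space_def chart_deriv_def by blast
  moreover have "range (chart_deriv V \<psi> p) \<subseteq> range (chart_deriv U \<phi> p)"
    if "(V, \<psi>) \<in> A" "p \<in> V" for V \<psi>
    using chart_deriv_change[OF assms that] by (auto intro: range_eqI)
  ultimately show ?thesis
    using assms by blast
qed

lemma linear_chart_deriv:
  assumes "(U, \<phi>) \<in> A" "p \<in> U"
  shows "linear (chart_deriv U \<phi> p)"
proof (rule linearI)
  have lin: "linear (frechet_derivative (f \<circ> inv_into U \<phi>) (at (\<phi> p)))" if "smooth_fun A f" for f
    using smooth_fun_differentiable[OF assms that] by (rule linear_frechet_derivative)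
  show "chart_deriv U \<phi> p (v + w) = chart_deriv U \<phi> p v + chart_deriv U \<phi> p w" for v w
    by (rule ext) (auto simp: chart_deriv_def linear_add lin)
  show "chart_deriv U \<phi> p (c *\<^sub>R v) = c *\<^sub>R chart_deriv U \<phi> p v" for c v
    by (rule ext) (auto simp: chart_deriv_def linear_scale lin)
qed

lemma subspace_tangent_space: "subspace (tangent_space A p)"
proof -
  obtain U \<phi> where "(U, \<phi>) \<in> A" "p \<in> U" by (rule chart_exists)
  then show ?thesis
    by (simp add: tangent_space_chart linear_subspace_image linear_chart_deriv)
qed

text \<open>The chart derivatives along the standard basis span the tangent space, so its dimension
  is at most \<open>CARD('n)\<close>; a vector outside \<open>span B\<close> would enlarge
  \<open>B\<close> to an independent set that is too big.\<close>

lemma tangent_space_subset_span: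
  assumes "independent B" "finite B" "card B = CARD('n)" "B \<subseteq> tangent_space A p"
  shows "tangent_space A p \<subseteq> span B"
proof
  fix v assume v: "v \<in> tangent_space A p"
  obtain U \<phi> where U: "(U, \<phi>) \<in> A" "p \<in> U" by (rule chart_exists)
  let ?T = "chart_deriv U \<phi> p ` Basis"
  have sp: "tangent_space A p = span ?T"
    by (simp add: tangent_space_chart[OF U] linear_span_image[OF linear_chart_deriv[OF U]])
  show "v \<in> span B"
  proof (rule ccontr)
    assume "v \<notin> span B"
    then have "independent (insert v B)" "v \<notin> B"
      using assms(1) independent_insertI span_base by blast+
    then have "card (insert v B) \<le> card ?T"
      using independent_span_bound[of ?T "insert v B"] assms(4) v sp by auto
    also have "\<dots> \<le> CARD('n)"
      using card_image_le[of "Basis :: (real ^ 'n) set" "chart_deriv U \<phi> p"] by simp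
    finally show False
      using assms(2,3) \<open>v \<notin> B\<close> by simp
  qed
qed

lemma tvec_nonsmooth: "v \<in> tangent_space A p \<Longrightarrow> \<not> smooth_fun A f \<Longrightarrow> v f = 0"
  unfolding tangent_space_def by auto

lemma tvec_const:
  assumes "v \<in> tangent_space A p"
  shows "v (\<lambda>q. c) = 0"
proof -
  obtain U \<phi> where U: "(U, \<phi>) \<in> A" "p \<in> U" by (rule chart_exists)
  then show ?thesis
    using assms by (auto simp: tangent_space_chart[OF U] chart_deriv_def o_def)
qed

lemma tvec_add:
  assumes "v \<in> tangent_space A p" "smooth_fun A f" "smooth_fun A h"
  shows "v (\<lambda>q. f q + h q) = v f + v h"
proof -
  obtain U \<phi> where U: "(U, \<phi>) \<in> A" "p \<in> U" by (rule chart_exists)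
  then show ?thesis
    using assms frechet_derivative_add_at[OF
        smooth_fun_differentiable[OF U assms(2)] smooth_fun_differentiable[OF U assms(3)]]
    by (auto simp: tangent_space_chart[OF U] chart_deriv_def o_def)
qed

lemma tvec_mult:
  assumes "v \<in> tangent_space A p" "smooth_fun A f" "smooth_fun A h"
  shows "v (\<lambda>q. f q * h q) = f p * v h + v f * h p"
proof -
  obtain U \<phi> where U: "(U, \<phi>) \<in> A" "p \<in> U" by (rule chart_exists)
  then show ?thesis
    using assms frechet_derivative_mult_at[OF
        smooth_fun_differentiable[OF U assms(2)] smooth_fun_differentiable[OF U assms(3)]]
    by (auto simp: tangent_space_chart[OF U] chart_deriv_def o_def chart_inv[OF U])
qed

section \<open>Vector fields\<close>

lemma vf_tangent: "vector_field A X \<Longrightarrow> X p \<in> tangent_space A p"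
  by (simp add: vector_field_def)

text \<open>True for every \<open>f\<close>: on a nonsmooth \<open>f\<close> tangent vectors take
  the default value 0. Bracket identities can therefore be checked on arbitrary functions, with no
  case distinction.\<close>

lemma smooth_vf_apply:
  assumes "vector_field A X"
  shows "smooth_fun A (vf_apply X f)"
proof (cases "smooth_fun A f")
  case True
  then show ?thesis using assms by (simp add: vector_field_def vf_apply_def)
next
  case False
  then have "vf_apply X f = (\<lambda>p. 0)"
    using tvec_nonsmooth[OF vf_tangent[OF assms]] by (auto simp: vf_apply_def)
  then show ?thesis by simp
qed

lemma smooth_vf_apply' [simp]: "vector_field A X \<Longrightarrow> smooth_fun A (\<lambda>p. X p f)"
  using smooth_vf_apply[of X f] by (simp add: vf_apply_def)

lemma vector_field_add [simp]:
  "vector_field A X \<Longrightarrow> vector_field A Y \<Longrightarrow> vector_field A (X + Y)"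
  by (auto simp: vector_field_def intro: subspace_add subspace_tangent_space)

lemma vector_field_zero [simp]: "vector_field A 0"
  by (simp add: vector_field_def subspace_0 subspace_tangent_space)

lemma vector_field_vf_scale [simp]:
  "smooth_fun A f \<Longrightarrow> vector_field A X \<Longrightarrow> vector_field A (vf_scale f X)"
  by (auto simp: vector_field_def vf_scale_def intro: subspace_scale subspace_tangent_space)

text \<open>Real scalars become constant functions, so that real homogeneity follows from
  homogeneity over the smooth functions.\<close>

lemma scaleR_eq_vf_scale: "c *\<^sub>R X = vf_scale (\<lambda>p. c) X"
  by (rule ext) (simp add: vf_scale_def)

lemma vector_field_scaleR [simp]: "vector_field A X \<Longrightarrow> vector_field A (c *\<^sub>R X)"
  by (simp add: scaleR_eq_vf_scale)

lemma vector_field_minus [simp]: "vector_field A X \<Longrightarrow> vector_field A (- X)"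
  using vector_field_scaleR[of X "-1"] by simp

lemma vector_field_diff [simp]:
  "vector_field A X \<Longrightarrow> vector_field A Y \<Longrightarrow> vector_field A (X - Y)"
  using vector_field_add[of X "- Y"] by simp

lemma vf_bracket_antisym: "vf_bracket X Y = - vf_bracket Y X"
  by (intro ext) (simp add: vf_bracket_def)

lemma vf_bracket_self: "vf_bracket X X = 0"
  by (intro ext) (simp add: vf_bracket_def)

lemma vf_bracket_add_left:
  assumes "vector_field A X" "vector_field A Y" "vector_field A Z"
  shows "vf_bracket (X + Z) Y = vf_bracket X Y + vf_bracket Z Y"
proof (intro ext)
  fix p f
  have "vf_apply (X + Z) f = (\<lambda>q. X q f + Z q f)"
    by (simp add: vf_apply_def)
  then show "vf_bracket (X + Z) Y p f = (vf_bracket X Y + vf_bracket Z Y) p f"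
    using assms by (simp add: vf_bracket_def tvec_add[OF vf_tangent[OF assms(2)]] vf_apply_def)
qed

lemma vf_bracket_scale_left:
  assumes "vector_field A X" "vector_field A Y" "smooth_fun A f"
  shows "vf_bracket (vf_scale f X) Y = vf_scale f (vf_bracket X Y) - vf_scale (vf_apply Y f) X"
proof (intro ext)
  fix p h
  have "vf_apply (vf_scale f X) h = (\<lambda>q. f q * X q h)"
    by (simp add: vf_apply_def vf_scale_def)
  then show "vf_bracket (vf_scale f X) Y p h
      = (vf_scale f (vf_bracket X Y) - vf_scale (vf_apply Y f) X) p h"
    using assms
    by (simp add: vf_bracket_def tvec_mult[OF vf_tangent[OF assms(2)]] vf_apply_def vf_scale_def
        algebra_simps)
qed

lemma vf_bracket_scaleR_left:
  assumes "vector_field A X" "vector_field A Y"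
  shows "vf_bracket (c *\<^sub>R X) Y = c *\<^sub>R vf_bracket X Y"
  using assms tvec_const[OF vf_tangent[OF assms(2)]] vf_bracket_scale_left[of X Y "\<lambda>p. c"]
  by (auto simp: scaleR_eq_vf_scale vf_scale_def vf_apply_def fun_eq_iff)

lemma vf_bracket_add_right:
  assumes "vector_field A X" "vector_field A Y" "vector_field A Z"
  shows "vf_bracket X (Y + Z) = vf_bracket X Y + vf_bracket X Z"
  using vf_bracket_add_left[OF assms(2,1,3)] vf_bracket_antisym[of X] by simp

lemma vf_bracket_scale_right:
  assumes "vector_field A X" "vector_field A Y" "smooth_fun A f"
  shows "vf_bracket X (vf_scale f Y) = vf_scale f (vf_bracket X Y) + vf_scale (vf_apply X f) Y"
  using vf_bracket_scale_left[OF assms(2,1,3)] vf_bracket_antisym[of X]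
  by (simp add: vf_scale_def fun_eq_iff)

section \<open>Tensor fields of type (1,2) and (0,2)\<close>

text \<open>Tensor fields are encoded by their characterization as maps on vector fields that are
  linear over the smooth functions, since connections and curvature act on fields and not on vectors
  at a point.\<close>

definition tensor12 :: "('g vfield \<Rightarrow> 'g vfield \<Rightarrow> 'g vfield) \<Rightarrow> bool"
  where "tensor12 S \<longleftrightarrow> (\<forall>X Y. vector_field A X \<longrightarrow> vector_field A Y \<longrightarrow>
    vector_field A (S X Y) \<and>
    (\<forall>Z. vector_field A Z \<longrightarrow> S (X + Z) Y = S X Y + S Z Y \<and> S X (Y + Z) = S X Y + S X Z) \<and>
    (\<forall>f. smooth_fun A f \<longrightarrow>
      S (vf_scale f X) Y = vf_scale f (S X Y) \<and> S X (vf_scale f Y) = vf_scale f (S X Y)))"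

definition tensor02 :: "('g vfield \<Rightarrow> 'g vfield \<Rightarrow> 'g \<Rightarrow> real) \<Rightarrow> bool"
  where "tensor02 T \<longleftrightarrow> (\<forall>X Y. vector_field A X \<longrightarrow> vector_field A Y \<longrightarrow>
    smooth_fun A (T X Y) \<and>
    (\<forall>Z. vector_field A Z \<longrightarrow> T (X + Z) Y = T X Y + T Z Y \<and> T X (Y + Z) = T X Y + T X Z) \<and>
    (\<forall>f. smooth_fun A f \<longrightarrow> T (vf_scale f X) Y = f * T X Y \<and> T X (vf_scale f Y) = f * T X Y))"

lemma tensor12_swap: "tensor12 S \<Longrightarrow> tensor12 (\<lambda>X Y. S Y X)"
  unfolding tensor12_def by blast

lemma tensor12_scaleR: "tensor12 S \<Longrightarrow> tensor12 (\<lambda>X Y. c *\<^sub>R S X Y)"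
  unfolding tensor12_def by (auto simp: vf_scale_def fun_eq_iff algebra_simps)

lemma tensor12_diff: "tensor12 S \<Longrightarrow> tensor12 S' \<Longrightarrow> tensor12 (\<lambda>X Y. S X Y - S' X Y)"
  unfolding tensor12_def by (auto simp: vf_scale_def fun_eq_iff algebra_simps)

text \<open>Connections form an affine space over the (1,2)-tensors: the subtracted term carries no
  derivative of \<open>f\<close>, so the Leibniz rule survives.\<close>

lemma affine_connection_diff_tensor12:
  "affine_connection A D \<Longrightarrow> tensor12 S \<Longrightarrow> affine_connection A (\<lambda>X Y. D X Y - S X Y)"
  unfolding tensor12_def affine_connection_def
  by (auto simp: vf_scale_def fun_eq_iff algebra_simps)

lemma tensor02_add: "tensor02 S \<Longrightarrow> tensor02 S' \<Longrightarrow> tensor02 (\<lambda>X Y. S X Y + S' X Y)"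
  unfolding tensor02_def plus_fun_def by (auto simp: fun_eq_iff algebra_simps)

lemma tensor02_scaleR: "tensor02 S \<Longrightarrow> tensor02 (\<lambda>X Y. c *\<^sub>R S X Y)"
  unfolding tensor02_def scaleR_fun_def by (auto simp: fun_eq_iff algebra_simps)

lemma tensor02_swap: "tensor02 S \<Longrightarrow> tensor02 (\<lambda>X Y. S Y X)"
  unfolding tensor02_def by blast

lemma tensor02D:
  assumes "tensor02 T" "vector_field A X" "vector_field A Y"
  shows "smooth_fun A (T X Y)"
    and "vector_field A Z \<Longrightarrow> T (X + Z) Y = T X Y + T Z Y"
    and "vector_field A Z \<Longrightarrow> T X (Y + Z) = T X Y + T X Z"
    and "smooth_fun A f \<Longrightarrow> T (vf_scale f X) Y = f * T X Y"
    and "smooth_fun A f \<Longrightarrow> T X (vf_scale f Y) = f * T X Y"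
    and "T (c *\<^sub>R X) Y = c *\<^sub>R T X Y"
    and "T X (c *\<^sub>R Y) = c *\<^sub>R T X Y"
  using assms unfolding tensor02_def scaleR_eq_vf_scale
  by (auto simp: scaleR_fun_def fun_eq_iff)

lemma tensor02_minus:
  assumes "tensor02 T" "vector_field A X" "vector_field A Y"
  shows "T (- X) Y = - T X Y" and "T X (- Y) = - T X Y"
  using tensor02D(6,7)[OF assms, of "-1"] by simp_all

lemma tensor02_zero:
  assumes "tensor02 T" "vector_field A X"
  shows "T 0 X = 0" and "T X 0 = 0"
  using tensor02D(6,7)[OF assms(1,2,2), of 0] by simp_all

section \<open>Product structures\<close>

lemma tensor_vf_product_structure:
  assumes "product_structure A J" "vector_field A X"
  shows "vector_field A (tensor_vf J X)"
    and "vector_field A Y \<Longrightarrow> tensor_vf J (X + Y) = tensor_vf J X + tensor_vf J Y"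
    and "smooth_fun A f \<Longrightarrow> tensor_vf J (vf_scale f X) = vf_scale f (tensor_vf J X)"
    and "tensor_vf J (c *\<^sub>R X) = c *\<^sub>R tensor_vf J X"
  using assms vf_tangent unfolding product_structure_def
  by (auto simp: tensor_vf_def vf_scale_def fun_eq_iff)

lemma tensor12_product_structure:
  assumes "product_structure A J" "tensor12 S"
  shows "tensor12 (\<lambda>X Y. S (tensor_vf J X) Y)"
  using assms tensor_vf_product_structure[OF assms(1)] unfolding tensor12_def by simp

text \<open>In the second slot both terms produce \<open>X(f) JY\<close> by the Leibniz rule, and
  these cancel.\<close>

lemma tensor12_cov_deriv:
  assumes "product_structure A J" "affine_connection A D"
  shows "tensor12 (cov_deriv_tensor D J)"
  using assms(2) tensor_vf_product_structure[OF assms(1)]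
  unfolding tensor12_def affine_connection_def cov_deriv_tensor_def
  by (simp add: smooth_vf_apply, simp add: vf_scale_def fun_eq_iff algebra_simps)

text \<open>All corrections to \<open>D\<close> are built from the covariant derivative of
  \<open>J\<close> by composing a slot with \<open>J\<close>, hence are tensors.\<close>

lemma affine_connection_kobayashi_nomizu:
  assumes J: "product_structure A J" and D: "affine_connection A D"
  shows "affine_connection A (kobayashi_nomizu D J)"
proof -
  note C = tensor12_cov_deriv[OF J D]
  \<comment> \<open>Composition with \<open>J\<close> is available for the first slot; swapping
    before and after moves it to the second.\<close>
  have 1: "tensor12 (\<lambda>X Y. cov_deriv_tensor D J X (tensor_vf J Y))"
    using tensor12_swap[OF tensor12_product_structure[OF J tensor12_swap[OF C]]] .
  have 2: "tensor12 (\<lambda>X Y. cov_deriv_tensor D J (tensor_vf J Y) X)"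
    using tensor12_swap[OF tensor12_product_structure[OF J C]] .
  have "affine_connection A (\<lambda>X Y. D X Y - (1/2) *\<^sub>R cov_deriv_tensor D J X (tensor_vf J Y) -
    (1/4) *\<^sub>R (cov_deriv_tensor D J Y (tensor_vf J X) - cov_deriv_tensor D J (tensor_vf J Y) X))"
    by (intro affine_connection_diff_tensor12 tensor12_scaleR tensor12_diff D 1 2 tensor12_swap[OF 1])
  moreover have "kobayashi_nomizu D J = (\<lambda>X Y. D X Y - (1/2) *\<^sub>R cov_deriv_tensor D J X (tensor_vf J Y) -
    (1/4) *\<^sub>R (cov_deriv_tensor D J Y (tensor_vf J X) - cov_deriv_tensor D J (tensor_vf J Y) X))"
    by (intro ext) (simp add: kobayashi_nomizu_def canonical_connection_def)
  ultimately show ?thesis by simp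
qed

section \<open>Curvature and Lie derivative are tensorial\<close>

lemma affine_connectionD:
  assumes "affine_connection A D" "vector_field A X" "vector_field A Y"
  shows "vector_field A (D X Y)"
    and "vector_field A Z \<Longrightarrow> D (X + Z) Y = D X Y + D Z Y"
    and "vector_field A Z \<Longrightarrow> D X (Y + Z) = D X Y + D X Z"
    and "smooth_fun A f \<Longrightarrow> D (vf_scale f X) Y = vf_scale f (D X Y)"
    and "smooth_fun A f \<Longrightarrow> D X (vf_scale f Y) = vf_scale (vf_apply X f) Y + vf_scale f (D X Y)"
  using assms unfolding affine_connection_def by blast+

text \<open>In the second slot the Leibniz term vanishes because tangent vectors annihilate
  constants.\<close>

lemma affine_connection_scaleR:
  assumes "affine_connection A D" "vector_field A X" "vector_field A Y"
  shows "D (c *\<^sub>R X) Y = c *\<^sub>R D X Y" and "D X (c *\<^sub>R Y) = c *\<^sub>R D X Y"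
  using assms affine_connectionD(4)[OF assms, of "\<lambda>p. c"] affine_connectionD(5)[OF assms, of "\<lambda>p. c"]
  by (auto simp: scaleR_eq_vf_scale vf_scale_def vf_apply_def fun_eq_iff tvec_const[OF vf_tangent])

lemma affine_connection_minus:
  assumes "affine_connection A D" "vector_field A X" "vector_field A Y"
  shows "D (- X) Y = - D X Y" and "D X (- Y) = - D X Y"
  using affine_connection_scaleR[OF assms, of "-1"] by simp_all

lemma affine_connection_zero:
  assumes "affine_connection A D" "vector_field A X"
  shows "D 0 X = 0" and "D X 0 = 0"
  using affine_connection_scaleR[OF assms(1,2,2), of 0] by simp_all

lemma affine_connection_diff_left:
  assumes "affine_connection A D" "vector_field A X" "vector_field A Y" "vector_field A Z"
  shows "D (X - Z) Y = D X Y - D Z Y"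
  using affine_connectionD(2)[OF assms(1-3), of "- Z"] affine_connection_minus(1)[OF assms(1,4,3)] assms(4)
  by simp

text \<open>The middle slot stays fixed because the Ricci tensor traces over it with frame fields.
  That brackets are vector fields is assumed here as \<open>br\<close>;
  \<open>vector_field_bracket\<close> supplies it once the frame brackets are known.\<close>

lemma tensor12_curvature:
  assumes D: "affine_connection A D" and Y: "vector_field A Y"
    and br: "\<And>X. vector_field A X \<Longrightarrow> vector_field A (vf_bracket X Y)"
  shows "tensor12 (\<lambda>X Z. curvature D X Y Z)"
  unfolding tensor12_def
proof (intro allI impI conjI)
  note [simp] = affine_connectionD[OF D] affine_connection_diff_left[OF D] Y br
  fix X Z assume X[simp]: "vector_field A X" and Z[simp]: "vector_field A Z"
  show "vector_field A (curvature D X Y Z)"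
    by (simp add: curvature_def)
  show "curvature D (X + W) Y Z = curvature D X Y Z + curvature D W Y Z" if "vector_field A W" for W
    using that by (simp add: curvature_def vf_bracket_add_left)
  show "curvature D X Y (Z + W) = curvature D X Y Z + curvature D X Y W" if "vector_field A W" for W
    using that by (simp add: curvature_def)
  fix f assume f[simp]: "smooth_fun A f"
  have [simp]: "smooth_fun A (vf_apply V f)" if "vector_field A V" for V
    using smooth_vf_apply that .
  \<comment> \<open>The term \<open>Y(f) D X Z\<close> from differentiating \<open>f (D X Z)\<close>
    cancels against the one from the bracket of \<open>f X\<close> with \<open>Y\<close>.\<close>
  show "curvature D (vf_scale f X) Y Z = vf_scale f (curvature D X Y Z)"
    by (simp add: curvature_def vf_bracket_scale_left) (simp add: vf_scale_def fun_eq_iff algebra_simps)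
  \<comment> \<open>The first-order terms in \<open>f\<close> cancel in pairs, and the second-order
    ones \<open>X(Y f) - Y(X f)\<close> are removed by the bracket acting on
    \<open>f\<close>.\<close>
  show "curvature D X Y (vf_scale f Z) = vf_scale f (curvature D X Y Z)"
    by (simp add: curvature_def)
       (simp add: vf_scale_def fun_eq_iff algebra_simps vf_bracket_def vf_apply_def)
qed

lemma vf_apply_add:
  assumes "vector_field A X" "smooth_fun A f" "smooth_fun A h"
  shows "vf_apply X (f + h) = vf_apply X f + vf_apply X h"
  using tvec_add[OF vf_tangent[OF assms(1)] assms(2,3)]
  by (simp add: vf_apply_def plus_fun_def)

lemma vf_apply_mult:
  assumes "vector_field A X" "smooth_fun A f" "smooth_fun A h"
  shows "vf_apply X (f * h) = f * vf_apply X h + vf_apply X f * h"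
  using tvec_mult[OF vf_tangent[OF assms(1)] assms(2,3)]
  by (simp add: vf_apply_def plus_fun_def times_fun_def)

text \<open>The terms with the derivative of \<open>f\<close> along \<open>\<xi>\<close> cancel: one
  comes from differentiating \<open>f * T X Y\<close>, the other from the bracket of
  \<open>\<xi>\<close> with the scaled field.\<close>

lemma tensor02_lie_derivative:
  assumes T: "tensor02 T" and \<xi>: "vector_field A \<xi>"
    and br: "\<And>X. vector_field A X \<Longrightarrow> vector_field A (vf_bracket \<xi> X)"
  shows "tensor02 (lie_derivative \<xi> T)"
  unfolding tensor02_def
proof (intro allI impI conjI)
  note [simp] = tensor02D(1-5)[OF T] \<xi> br vf_bracket_add_right vf_bracket_scale_right
    vf_apply_add vf_apply_mult smooth_vf_apply
  fix X Y assume X[simp]: "vector_field A X" and Y[simp]: "vector_field A Y"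
  show "smooth_fun A (lie_derivative \<xi> T X Y)"
    unfolding lie_derivative_def fun_diff_def
    using smooth_vf_apply[OF \<xi>] tensor02D(1)[OF T] br by (intro smooth_fun_diff) auto
  show "lie_derivative \<xi> T (X + Z) Y = lie_derivative \<xi> T X Y + lie_derivative \<xi> T Z Y"
    "lie_derivative \<xi> T X (Y + Z) = lie_derivative \<xi> T X Y + lie_derivative \<xi> T X Z"
    if "vector_field A Z" for Z
    using that by (simp_all add: lie_derivative_def)
  fix f assume f[simp]: "smooth_fun A f"
  show "lie_derivative \<xi> T (vf_scale f X) Y = f * lie_derivative \<xi> T X Y"
    "lie_derivative \<xi> T X (vf_scale f Y) = f * lie_derivative \<xi> T X Y"
    by (simp_all add: lie_derivative_def algebra_simps)
qed

end

section \<open>Pseudo-orthonormal frames\<close>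

locale lorentz_frame = smooth_manifold A
  for A :: "('g::topological_space, 3) chart set" +
  fixes g :: "'g bilinear_field" and e1 e2 e3 :: "'g vfield"
  assumes metric: "lorentzian_metric A g"
    and vf [simp]: "vector_field A e1" "vector_field A e2" "vector_field A e3"
    and orthonormal: "pseudo_orthonormal g e1 e2 e3"
begin

lemma metric_at:
  assumes "u \<in> tangent_space A p" "v \<in> tangent_space A p"
  shows "g p u v = g p v u" and "g p (c *\<^sub>R u) v = c * g p u v"
    and "w \<in> tangent_space A p \<Longrightarrow> g p (u + w) v = g p u v + g p w v"
  using metric[unfolded lorentzian_metric_def, THEN conjunct1, rule_format, OF assms] by simp_all

lemma metric_vf_sym: "vector_field A X \<Longrightarrow> vector_field A Y \<Longrightarrow> metric_vf g X Y = metric_vf g Y X"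
  unfolding metric_vf_def by (rule ext) (rule metric_at(1)[OF vf_tangent vf_tangent])

lemma tensor02_metric: "tensor02 (metric_vf g)"
proof -
  have left: "metric_vf g (X + Z) Y = metric_vf g X Y + metric_vf g Z Y"
      "metric_vf g (vf_scale f X) Y = f * metric_vf g X Y"
    if "vector_field A X" "vector_field A Y" "vector_field A Z" for X Y Z f
    using metric_at[OF that(1,2)[THEN vf_tangent]] vf_tangent[OF that(3)]
    by (simp_all add: metric_vf_def fun_eq_iff vf_scale_def)
  moreover have "smooth_fun A (metric_vf g X Y)" if "vector_field A X" "vector_field A Y" for X Y
    using metric[unfolded lorentzian_metric_def, THEN conjunct2, THEN conjunct2] that by simp
  moreover have "metric_vf g X (Y + Z) = metric_vf g X Y + metric_vf g X Z"
    if "vector_field A X" "vector_field A Y" "vector_field A Z" for X Y Z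
    using left(1)[of Y X Z] metric_vf_sym[of X] that by simp
  moreover have "metric_vf g X (vf_scale f Y) = f * metric_vf g X Y"
    if "vector_field A X" "vector_field A Y" "smooth_fun A f" for X Y f
    using left(2)[of Y X Y f] metric_vf_sym[of X] that by simp
  ultimately show ?thesis unfolding tensor02_def by blast
qed

lemma frame_metric:
  "metric_vf g e1 e1 = (\<lambda>p. 1)" "metric_vf g e2 e2 = (\<lambda>p. 1)" "metric_vf g e3 e3 = (\<lambda>p. -1)"
  "metric_vf g e1 e2 = (\<lambda>p. 0)" "metric_vf g e1 e3 = (\<lambda>p. 0)" "metric_vf g e2 e3 = (\<lambda>p. 0)"
  "metric_vf g e2 e1 = (\<lambda>p. 0)" "metric_vf g e3 e1 = (\<lambda>p. 0)" "metric_vf g e3 e2 = (\<lambda>p. 0)"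
  using orthonormal metric_vf_sym[of e2 e1] metric_vf_sym[of e3 e1] metric_vf_sym[of e3 e2]
  by (auto simp: metric_vf_def pseudo_orthonormal_def fun_eq_iff)

lemma frame_combination:
  "metric_vf g (a *\<^sub>R e1 + b *\<^sub>R e2 + c *\<^sub>R e3) e1 = (\<lambda>p. a)"
  "metric_vf g (a *\<^sub>R e1 + b *\<^sub>R e2 + c *\<^sub>R e3) e2 = (\<lambda>p. b)"
  "metric_vf g (a *\<^sub>R e1 + b *\<^sub>R e2 + c *\<^sub>R e3) e3 = (\<lambda>p. - c)"
  using tensor02D[OF tensor02_metric] by (auto simp: frame_metric fun_eq_iff)

lemma frame_coefficients_at:
  assumes "v = a *\<^sub>R e1 p + b *\<^sub>R e2 p + c *\<^sub>R e3 p"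
  shows "g p v (e1 p) = a" "g p v (e2 p) = b" "g p v (e3 p) = - c"
  using assms fun_cong[OF frame_combination(1), of a b c p] fun_cong[OF frame_combination(2), of a b c p]
    fun_cong[OF frame_combination(3), of a b c p]
  by (simp_all add: metric_vf_def)

text \<open>Orthonormality makes the frame independent at \<open>p\<close>, and three independent
  vectors span a tangent space of dimension at most three.\<close>

lemma frame_expansion_at:
  assumes v: "v \<in> tangent_space A p"
  shows "\<exists>a b c. v = a *\<^sub>R e1 p + b *\<^sub>R e2 p + c *\<^sub>R e3 p"
proof -
  note at = frame_coefficients_at[of _ _ p]
  \<comment> \<open>Here and in the next two claims a dependence would give one vector two
    expansions, and pairing with a frame vector reads off two different values of the same
    coefficient.\<close>
  have 3: "e3 p \<noteq> 0"
    using at(3)[of "e3 p" 0 0 1] at(3)[of "e3 p" 0 0 0] by auto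
  have 2: "e2 p \<notin> span {e3 p}"
    using at(2)[of "e2 p" 0 1 0] at(2)[of "e2 p" 0 0] by (auto simp: span_singleton)
  have 1: "e1 p \<notin> span {e2 p, e3 p}"
    using at(1)[of "e1 p" 1 0 0] at(1)[of "e1 p" 0]
    by (auto simp: span_breakdown_eq[of _ "e2 p"] span_singleton diff_eq_eq add.commute)
  have "independent {e1 p, e2 p, e3 p}"
    using 1 2 3 by (intro independent_insertI independent_empty) auto
  moreover have "card {e1 p, e2 p, e3 p} = CARD(3)"
  proof -
    have "e1 p \<noteq> e2 p" "e1 p \<noteq> e3 p" "e2 p \<noteq> e3 p"
      using 1 2 by (auto intro: span_base)
    then show ?thesis by simp
  qed
  ultimately have "v \<in> span {e1 p, e2 p, e3 p}"
    using tangent_space_subset_span[of "{e1 p, e2 p, e3 p}" p] v by (auto simp: vf_tangent)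
  then show ?thesis
    by (auto simp: span_breakdown_eq[of _ "e1 p"] span_breakdown_eq[of _ "e2 p"] span_singleton
        algebra_simps) metis
qed

text \<open>The coefficients are metric products, hence smooth; the sign at \<open>e3\<close>
  compensates \<open>g(e3, e3) = -1\<close>.\<close>

lemma frame_expansion:
  assumes "vector_field A X"
  shows "X = vf_scale (metric_vf g X e1) e1 + vf_scale (metric_vf g X e2) e2
    + vf_scale (- metric_vf g X e3) e3"
proof (rule ext)
  fix p
  obtain a b c where "X p = a *\<^sub>R e1 p + b *\<^sub>R e2 p + c *\<^sub>R e3 p"
    using frame_expansion_at[OF vf_tangent[OF assms, of p]] by blast
  with frame_coefficients_at[OF this] show
    "X p = (vf_scale (metric_vf g X e1) e1 + vf_scale (metric_vf g X e2) e2
      + vf_scale (- metric_vf g X e3) e3) p"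
    by (simp add: vf_scale_def metric_vf_def)
qed

lemma smooth_metric_vf [simp]:
  "vector_field A X \<Longrightarrow> vector_field A Y \<Longrightarrow> smooth_fun A (metric_vf g X Y)"
  "vector_field A X \<Longrightarrow> vector_field A Y \<Longrightarrow> smooth_fun A (- metric_vf g X Y)"
  using tensor02D(1)[OF tensor02_metric] smooth_fun_minus[of "metric_vf g X Y"]
  by (simp_all add: fun_Compl_def)

text \<open>Used to recover \<open>nabla\<close> from the Koszul formula, which gives only its
  metric products.\<close>

lemma vf_eq_iff_metric:
  assumes "vector_field A X"
  shows "X = a *\<^sub>R e1 + b *\<^sub>R e2 + c *\<^sub>R e3 \<longleftrightarrow>
    (\<forall>p. metric_vf g X e1 p = a \<and> metric_vf g X e2 p = b \<and> metric_vf g X e3 p = - c)"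
proof
  assume "\<forall>p. metric_vf g X e1 p = a \<and> metric_vf g X e2 p = b \<and> metric_vf g X e3 p = - c"
  then show "X = a *\<^sub>R e1 + b *\<^sub>R e2 + c *\<^sub>R e3"
    by (subst frame_expansion[OF assms]) (simp add: fun_eq_iff vf_scale_def)
qed (simp add: frame_combination)

text \<open>The vector fields form the module generated by the frame over the smooth
  functions.\<close>

lemma frame_induct:
  assumes "vector_field A X"
    and "P e1" "P e2" "P e3"
    and "\<And>X Y. vector_field A X \<Longrightarrow> vector_field A Y \<Longrightarrow> P X \<Longrightarrow> P Y \<Longrightarrow> P (X + Y)"
    and "\<And>f X. smooth_fun A f \<Longrightarrow> vector_field A X \<Longrightarrow> P X \<Longrightarrow> P (vf_scale f X)"
  shows "P X"
  by (subst frame_expansion[OF assms(1)]) (simp add: assms)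

lemma tensor02_frame_expansion:
  assumes T: "tensor02 T" and XY: "vector_field A X" "vector_field A Y"
  shows "T X Y = metric_vf g X e1 * T e1 Y + metric_vf g X e2 * T e2 Y + - metric_vf g X e3 * T e3 Y"
proof -
  \<comment> \<open>The coefficients are kept generic at first: the actual ones contain
    \<open>X\<close>, and expanding \<open>X\<close> would expand it inside them too.\<close>
  have "T (vf_scale f e1 + vf_scale h e2 + vf_scale k e3) Y = f * T e1 Y + h * T e2 Y + k * T e3 Y"
    if "smooth_fun A f" "smooth_fun A h" "smooth_fun A k" for f h k
    using that XY(2) by (simp add: tensor02D(2,4)[OF T])
  from this[of "metric_vf g X e1" "metric_vf g X e2" "- metric_vf g X e3"]
  show ?thesis
    unfolding frame_expansion[OF XY(1), symmetric] using XY(1) by simp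
qed

lemma tensor02_zero_on_frame:
  assumes T: "tensor02 T" and XY: "vector_field A X" "vector_field A Y"
    and E: "T e1 e1 = 0" "T e1 e2 = 0" "T e1 e3 = 0" "T e2 e1 = 0" "T e2 e2 = 0" "T e2 e3 = 0"
      "T e3 e1 = 0" "T e3 e2 = 0" "T e3 e3 = 0"
  shows "T X Y = 0"
proof -
  have "T e1 Y = 0" "T e2 Y = 0" "T e3 Y = 0"
    using tensor02_frame_expansion[OF tensor02_swap[OF T] XY(2) vf(1)]
      tensor02_frame_expansion[OF tensor02_swap[OF T] XY(2) vf(2)]
      tensor02_frame_expansion[OF tensor02_swap[OF T] XY(2) vf(3)]
    by (simp_all add: E)
  then show ?thesis
    by (simp add: tensor02_frame_expansion[OF T XY])
qed

lemma tensor02_metric_tensor12: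
  assumes "tensor12 S" "vector_field A Z"
  shows "tensor02 (\<lambda>X Y. metric_vf g (S X Y) Z)"
  using assms(1) unfolding tensor12_def tensor02_def
  by (simp add: tensor02D[OF tensor02_metric] assms(2))

section \<open>The Koszul formula\<close>

lemma levi_civita_affine: "levi_civita A g nabla \<Longrightarrow> affine_connection A nabla"
  by (simp add: levi_civita_def)

lemma koszul:
  assumes lc: "levi_civita A g nabla"
    and [simp]: "vector_field A X" "vector_field A Y" "vector_field A Z"
  shows "2 * metric_vf g (nabla X Y) Z p =
    vf_apply X (metric_vf g Y Z) p + vf_apply Y (metric_vf g X Z) p - vf_apply Z (metric_vf g X Y) p
    + metric_vf g (vf_bracket X Y) Z p - metric_vf g (vf_bracket X Z) Y p - metric_vf g (vf_bracket Y Z) X p"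
proof -
  note aff = levi_civita_affine[OF lc]
  note vf_nabla [simp] = affine_connectionD(1)[OF aff]
  have br: "metric_vf g (vf_bracket U V) W p = metric_vf g (nabla U V) W p - metric_vf g (nabla V U) W p"
    if "vector_field A U" "vector_field A V" "vector_field A W" for U V W
  proof -
    have "nabla U V = vf_bracket U V + nabla V U"
      using lc that unfolding levi_civita_def by (metis diff_add_cancel)
    \<comment> \<open>By vanishing torsion the bracket is a difference of two covariant derivatives,
      which are vector fields.\<close>
    moreover have "vector_field A (vf_bracket U V)"
      using lc that vf_nabla vector_field_diff unfolding levi_civita_def by metis
    ultimately show ?thesis
      using that by (simp add: tensor02D(2)[OF tensor02_metric])
  qed
  \<comment> \<open>Symmetry moves every covariant derivative to the first slot of the metric, so
    that the formula becomes a linear identity in these products.\<close>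
  have compat: "vf_apply U (metric_vf g V W) p = metric_vf g (nabla U V) W p + metric_vf g (nabla U W) V p"
    if "vector_field A U" "vector_field A V" "vector_field A W" for U V W
  proof -
    have "vf_apply U (metric_vf g V W) = metric_vf g (nabla U V) W + metric_vf g V (nabla U W)"
      using lc that unfolding levi_civita_def by blast
    then show ?thesis
      using that metric_vf_sym[of V "nabla U W"] by simp
  qed
  show ?thesis
    by (simp add: br compat)
qed

end

section \<open>Connections, Ricci tensor and Lie derivatives for the given bracket relations\<close>

locale unimodular_lorentz_frame = lorentz_frame A g e1 e2 e3
  for A :: "('g::topological_space, 3) chart set" and g e1 e2 e3 +
  fixes \<alpha> \<beta> \<gamma> :: real
  assumes frame_bracket: "vf_bracket e1 e2 = (- \<gamma>) *\<^sub>R e3" "vf_bracket e1 e3 = (- \<beta>) *\<^sub>R e2"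
    "vf_bracket e2 e3 = \<alpha> *\<^sub>R e1"
begin

lemma frame_bracket_swap:
  "vf_bracket e2 e1 = \<gamma> *\<^sub>R e3" "vf_bracket e3 e1 = \<beta> *\<^sub>R e2" "vf_bracket e3 e2 = (- \<alpha>) *\<^sub>R e1"
  using frame_bracket vf_bracket_antisym[of e2 e1] vf_bracket_antisym[of e3 e1] vf_bracket_antisym[of e3 e2]
  by simp_all

lemmas frame_brackets = frame_bracket frame_bracket_swap vf_bracket_self

text \<open>Frame induction in the first slot: scaling by \<open>f\<close> adds only a multiple of
  \<open>X\<close> by \<open>Y(f)\<close>, which is again a vector field.\<close>

lemma vector_field_bracket_frame:
  assumes X: "vector_field A X" and Y: "vector_field A Y"
    and "vector_field A (vf_bracket e1 Y)" "vector_field A (vf_bracket e2 Y)" "vector_field A (vf_bracket e3 Y)"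
  shows "vector_field A (vf_bracket X Y)"
  using X
proof (rule frame_induct[where P = "\<lambda>X. vector_field A (vf_bracket X Y)"])
  show "vector_field A (vf_bracket (X + Z) Y)"
    if "vector_field A X" "vector_field A Z" "vector_field A (vf_bracket X Y)" "vector_field A (vf_bracket Z Y)"
    for X Z
    using that Y by (simp add: vf_bracket_add_left)
  show "vector_field A (vf_bracket (vf_scale f X) Y)"
    if "smooth_fun A f" "vector_field A X" "vector_field A (vf_bracket X Y)" for f X
    using that Y by (simp add: vf_bracket_scale_left smooth_vf_apply)
qed (use assms in auto)

lemma vector_field_bracket:
  assumes "vector_field A X" and Y: "vector_field A Y"
  shows "vector_field A (vf_bracket X Y)"
proof -
  \<comment> \<open>The general field is expanded in the first slot against frame fields, where the
    brackets are given; antisymmetry then prepares the expansion of \<open>X\<close>.\<close>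
  have "vector_field A (vf_bracket Y e)" if "e \<in> {e1, e2, e3}" for e
    using that by (intro vector_field_bracket_frame[OF Y]) (auto simp: frame_brackets)
  then have "vector_field A (vf_bracket e Y)" if "e \<in> {e1, e2, e3}" for e
    using that vf_bracket_antisym[of e Y] by simp
  then show ?thesis
    by (intro vector_field_bracket_frame[OF assms]) auto
qed

lemma tensor02_ricci_sym:
  assumes "affine_connection A D"
  shows "tensor02 (ricci_sym g e1 e2 e3 D)"
proof -
  have curv: "tensor02 (\<lambda>X Y. metric_vf g (curvature D X e Y) e)" if "vector_field A e" for e
    using that by (intro tensor02_metric_tensor12 tensor12_curvature assms vector_field_bracket)
  have "tensor02 (\<lambda>X Y. (-1) *\<^sub>R metric_vf g (curvature D X e1 Y) e1
    + (-1) *\<^sub>R metric_vf g (curvature D X e2 Y) e2 + metric_vf g (curvature D X e3 Y) e3)"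
    by (intro tensor02_add tensor02_scaleR curv vf)
  then have ricci: "tensor02 (ricci g e1 e2 e3 D)"
    by (simp add: ricci_def[abs_def])
  show ?thesis
    using tensor02_scaleR[OF tensor02_add[OF ricci tensor02_swap[OF ricci]], of "1/2"]
    by (simp add: ricci_sym_def[abs_def])
qed

lemma frame_bracket_combination:
  "vf_bracket (a *\<^sub>R e1 + b *\<^sub>R e2 + c *\<^sub>R e3) e1 = (c * \<beta>) *\<^sub>R e2 + (b * \<gamma>) *\<^sub>R e3"
  "vf_bracket (a *\<^sub>R e1 + b *\<^sub>R e2 + c *\<^sub>R e3) e2 = (- c * \<alpha>) *\<^sub>R e1 + (- a * \<gamma>) *\<^sub>R e3"
  "vf_bracket (a *\<^sub>R e1 + b *\<^sub>R e2 + c *\<^sub>R e3) e3 = (b * \<alpha>) *\<^sub>R e1 + (- a * \<beta>) *\<^sub>R e2"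
  by (simp_all add: vf_bracket_add_left vf_bracket_scaleR_left frame_brackets)

text \<open>The metric is constant on the frame, so the Koszul formula keeps only its bracket
  terms.\<close>

lemma levi_civita_frame:
  assumes "levi_civita A g nabla"
  shows "nabla e1 e1 = 0" "nabla e2 e2 = 0" "nabla e3 e3 = 0"
    and "nabla e1 e2 = ((\<alpha> - \<beta> - \<gamma>) / 2) *\<^sub>R e3" and "nabla e2 e1 = ((\<alpha> - \<beta> + \<gamma>) / 2) *\<^sub>R e3"
    and "nabla e1 e3 = ((\<alpha> - \<beta> - \<gamma>) / 2) *\<^sub>R e2" and "nabla e3 e1 = ((\<alpha> + \<beta> - \<gamma>) / 2) *\<^sub>R e2"
    and "nabla e2 e3 = ((\<alpha> - \<beta> + \<gamma>) / 2) *\<^sub>R e1" and "nabla e3 e2 = ((\<gamma> - \<alpha> - \<beta>) / 2) *\<^sub>R e1"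
proof -
  note aff = levi_civita_affine[OF assms]
  \<comment> \<open>\<open>K\<close> is this surviving part, so
    \<open>metric_vf g (nabla i j) k\<close> is half of it.\<close>
  define K where "K i j k p = metric_vf g (vf_bracket i j) k p - metric_vf g (vf_bracket i k) j p
    - metric_vf g (vf_bracket j k) i p" for i j k p
  have const: "vf_apply X (\<lambda>p. c) p = 0" if "vector_field A X" for X c p
    using that by (simp add: vf_apply_def tvec_const[OF vf_tangent])
  have half: "metric_vf g (nabla i j) k p = K i j k p / 2"
    if "i \<in> {e1, e2, e3}" "j \<in> {e1, e2, e3}" "k \<in> {e1, e2, e3}" for i j k p
  proof -
    have ijk: "vector_field A i" "vector_field A j" "vector_field A k"
      using that by auto
    have der: "vf_apply a (metric_vf g b c) p = 0"
      if "vector_field A a" "b \<in> {e1, e2, e3}" "c \<in> {e1, e2, e3}" for a b c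
      using that by (auto simp: frame_metric const)
    show ?thesis
      using koszul[OF assms ijk, of p] der[OF ijk(1) that(2,3)] der[OF ijk(2) that(1,3)]
        der[OF ijk(3) that(1,2)] by (simp add: K_def)
  qed
  have eq: "nabla i j = (a / 2) *\<^sub>R e1 + (b / 2) *\<^sub>R e2 + (- c / 2) *\<^sub>R e3"
    if "i \<in> {e1, e2, e3}" "j \<in> {e1, e2, e3}"
      "\<And>p. K i j e1 p = a" "\<And>p. K i j e2 p = b" "\<And>p. K i j e3 p = c" for i j a b c
  proof -
    have "vector_field A (nabla i j)"
      using affine_connectionD(1)[OF aff] that(1,2) by auto
    moreover have "metric_vf g (nabla i j) e1 p = a / 2" "metric_vf g (nabla i j) e2 p = b / 2"
      "metric_vf g (nabla i j) e3 p = c / 2" for p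
      using half[OF that(1,2), of e1 p] half[OF that(1,2), of e2 p] half[OF that(1,2), of e3 p] that(3-5)
      by simp_all
    ultimately show ?thesis
      by (intro vf_eq_iff_metric[THEN iffD2]) simp_all
  qed
  note S = K_def frame_metric frame_brackets tensor02D(6)[OF tensor02_metric] tensor02_minus[OF tensor02_metric]
    tensor02_zero[OF tensor02_metric]
  show "nabla e1 e1 = 0"
    by (rule trans[OF eq[of e1 e1 "0" "0" "0"]]) (simp_all add: S)
  show "nabla e2 e2 = 0"
    by (rule trans[OF eq[of e2 e2 "0" "0" "0"]]) (simp_all add: S)
  show "nabla e3 e3 = 0"
    by (rule trans[OF eq[of e3 e3 "0" "0" "0"]]) (simp_all add: S)
  \<comment> \<open>The last three arguments of \<open>eq\<close> are the values of \<open>K\<close>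
    against \<open>e1\<close>, \<open>e2\<close>, \<open>e3\<close>; the one against
    \<open>e3\<close> has the opposite sign because \<open>e3\<close> is timelike.\<close>
  show "nabla e1 e2 = ((\<alpha> - \<beta> - \<gamma>) / 2) *\<^sub>R e3"
    by (rule trans[OF eq[of e1 e2 "0" "0" "- (\<alpha> - \<beta> - \<gamma>)"]]) (simp_all add: S)
  show "nabla e2 e1 = ((\<alpha> - \<beta> + \<gamma>) / 2) *\<^sub>R e3"
    by (rule trans[OF eq[of e2 e1 "0" "0" "- (\<alpha> - \<beta> + \<gamma>)"]]) (simp_all add: S)
  show "nabla e1 e3 = ((\<alpha> - \<beta> - \<gamma>) / 2) *\<^sub>R e2"
    by (rule trans[OF eq[of e1 e3 "0" "(\<alpha> - \<beta> - \<gamma>)" "0"]]) (simp_all add: S)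
  show "nabla e3 e1 = ((\<alpha> + \<beta> - \<gamma>) / 2) *\<^sub>R e2"
    by (rule trans[OF eq[of e3 e1 "0" "(\<alpha> + \<beta> - \<gamma>)" "0"]]) (simp_all add: S)
  show "nabla e2 e3 = ((\<alpha> - \<beta> + \<gamma>) / 2) *\<^sub>R e1"
    by (rule trans[OF eq[of e2 e3 "(\<alpha> - \<beta> + \<gamma>)" "0" "0"]]) (simp_all add: S)
  show "nabla e3 e2 = ((\<gamma> - \<alpha> - \<beta>) / 2) *\<^sub>R e1"
    by (rule trans[OF eq[of e3 e2 "\<gamma> - \<alpha> - \<beta>" "0" "0"]]) (simp_all add: S)
qed

text \<open>The eigenspaces of \<open>J\<close> are spanned by \<open>e1, e2\<close> and by
  \<open>e3\<close>. For \<open>X\<close> and \<open>Y\<close> from different ones,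
  \<open>D X Y\<close> comes out as the part of the bracket of \<open>X\<close> and \<open>Y\<close>
  in the eigenspace of \<open>Y\<close>; all other values vanish.\<close>

lemma kobayashi_nomizu_frame:
  assumes lc: "levi_civita A g nabla" and J: "product_structure A J"
    and Je: "tensor_vf J e1 = e1" "tensor_vf J e2 = e2" "tensor_vf J e3 = - e3"
  defines "D \<equiv> kobayashi_nomizu nabla J"
  shows "D e1 e1 = 0" "D e1 e2 = 0" "D e1 e3 = 0" "D e2 e1 = 0" "D e2 e2 = 0" "D e2 e3 = 0"
    and "D e3 e1 = \<beta> *\<^sub>R e2" and "D e3 e2 = (- \<alpha>) *\<^sub>R e1" and "D e3 e3 = 0"
proof -
  note aff = levi_civita_affine[OF lc]
  have J0: "tensor_vf J 0 = 0"
    using tensor_vf_product_structure(4)[OF J vf(1), of 0] by simp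
  have Jminus: "tensor_vf J (- X) = - tensor_vf J X" if "vector_field A X" for X
    using tensor_vf_product_structure(4)[OF J that, of "-1"] by simp
  define a b c where abc: "a = (\<alpha> - \<beta> - \<gamma>) / 2" "b = (\<alpha> - \<beta> + \<gamma>) / 2" "c = (\<alpha> + \<beta> - \<gamma>) / 2"
  have minus_c: "(\<gamma> - \<alpha> - \<beta>) / 2 = - c"
    by (simp add: abc field_simps)
  have coeffs: "\<alpha> = b + c" "\<beta> = c - a"
    by (simp_all add: abc field_simps)
  have N: "nabla e1 e1 = 0" "nabla e1 e2 = a *\<^sub>R e3" "nabla e1 e3 = a *\<^sub>R e2"
    "nabla e2 e1 = b *\<^sub>R e3" "nabla e2 e2 = 0" "nabla e2 e3 = b *\<^sub>R e1"
    "nabla e3 e1 = c *\<^sub>R e2" "nabla e3 e2 = (- c) *\<^sub>R e1" "nabla e3 e3 = 0"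
    using levi_civita_frame[OF lc, unfolded minus_c abc[symmetric]] by simp_all
  define C where "C = cov_deriv_tensor nabla J"
  \<comment> \<open>\<open>nabla e3\<close> preserves both eigenspaces of \<open>J\<close>, so
    \<open>C e3\<close> vanishes. \<open>nabla e1\<close> and \<open>nabla e2\<close> interchange
    them, which doubles their values up to sign.\<close>
  have Cij: "C e1 e1 = 0" "C e1 e2 = (2 * a) *\<^sub>R e3" "C e1 e3 = (- 2 * a) *\<^sub>R e2"
    "C e2 e1 = (2 * b) *\<^sub>R e3" "C e2 e2 = 0" "C e2 e3 = (- 2 * b) *\<^sub>R e1"
    "C e3 e1 = 0" "C e3 e2 = 0" "C e3 e3 = 0"
    by (simp_all add: C_def cov_deriv_tensor_def Je N J0 Jminus affine_connection_minus[OF aff]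
        tensor_vf_product_structure(4)[OF J] fun_eq_iff)
  have C_minus: "C (- X) Y = - C X Y" "C X (- Y) = - C X Y" if "vector_field A X" "vector_field A Y" for X Y
    using that unfolding C_def cov_deriv_tensor_def
    by (simp_all add: Jminus affine_connection_minus[OF aff] tensor_vf_product_structure(1)[OF J]
        affine_connectionD(1)[OF aff])
  have KN: "D X Y = nabla X Y - (1/2) *\<^sub>R C X (tensor_vf J Y)
      - (1/4) *\<^sub>R (C Y (tensor_vf J X) - C (tensor_vf J Y) X)" for X Y
    by (simp add: D_def C_def kobayashi_nomizu_def canonical_connection_def)
  note S = KN Je N Cij C_minus fun_eq_iff
  show "D e1 e1 = 0" "D e1 e2 = 0" "D e1 e3 = 0" "D e2 e1 = 0" "D e2 e2 = 0" "D e2 e3 = 0"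
    by (simp_all add: S)
  show "D e3 e1 = \<beta> *\<^sub>R e2" "D e3 e2 = (- \<alpha>) *\<^sub>R e1" "D e3 e3 = 0"
    by (simp_all add: S coeffs algebra_simps)
qed

text \<open>On the frame the products of two covariant derivatives cancel, leaving minus
  \<open>D\<close> along the bracket. Among brackets of distinct frame fields only that of
  \<open>e1\<close> and \<open>e2\<close> has an \<open>e3\<close> component, so the curvature of
  this pair is \<open>\<gamma>\<close> times \<open>D e3\<close> and the other pairs are
  flat.\<close>

lemma ricci_sym_frame:
  assumes D: "affine_connection A D"
    and De: "D e1 e1 = 0" "D e1 e2 = 0" "D e1 e3 = 0" "D e2 e1 = 0" "D e2 e2 = 0" "D e2 e3 = 0"
      "D e3 e1 = \<beta> *\<^sub>R e2" "D e3 e2 = (- \<alpha>) *\<^sub>R e1" "D e3 e3 = 0"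
  defines "T \<equiv> ricci_sym g e1 e2 e3 D"
  shows "T e1 e1 = (\<lambda>p. - \<beta> * \<gamma>)" and "T e2 e2 = (\<lambda>p. - \<alpha> * \<gamma>)" and "T e3 e3 = (\<lambda>p. 0)"
    and "T e1 e2 = (\<lambda>p. 0)" and "T e2 e1 = (\<lambda>p. 0)" and "T e1 e3 = (\<lambda>p. 0)" and "T e3 e1 = (\<lambda>p. 0)"
    and "T e2 e3 = (\<lambda>p. 0)" and "T e3 e2 = (\<lambda>p. 0)"
proof -
  note S = T_def ricci_sym_def ricci_def curvature_def De frame_brackets frame_metric
    affine_connection_zero[OF D] affine_connection_minus[OF D] affine_connection_scaleR[OF D]
    tensor02D(6)[OF tensor02_metric] tensor02_minus[OF tensor02_metric]
    tensor02_zero[OF tensor02_metric]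
  show "T e1 e1 = (\<lambda>p. - \<beta> * \<gamma>)" "T e2 e2 = (\<lambda>p. - \<alpha> * \<gamma>)" "T e3 e3 = (\<lambda>p. 0)"
    "T e1 e2 = (\<lambda>p. 0)" "T e2 e1 = (\<lambda>p. 0)" "T e1 e3 = (\<lambda>p. 0)" "T e3 e1 = (\<lambda>p. 0)"
    "T e2 e3 = (\<lambda>p. 0)" "T e3 e2 = (\<lambda>p. 0)"
    by (simp_all add: S fun_eq_iff)
qed

text \<open>Only the frame values of \<open>T\<close> enter: they are constant, so its derivative
  along \<open>\<xi>\<close> drops out and the bracket terms alone remain.\<close>

lemma lie_derivative_diagonal:
  assumes T: "tensor02 T"
    and Te: "T e1 e1 = (\<lambda>p. - \<beta> * \<gamma>)" "T e2 e2 = (\<lambda>p. - \<alpha> * \<gamma>)" "T e3 e3 = (\<lambda>p. 0)"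
      "T e1 e2 = (\<lambda>p. 0)" "T e2 e1 = (\<lambda>p. 0)" "T e1 e3 = (\<lambda>p. 0)" "T e3 e1 = (\<lambda>p. 0)"
      "T e2 e3 = (\<lambda>p. 0)" "T e3 e2 = (\<lambda>p. 0)"
  shows "(\<forall>X Y. vector_field A X \<longrightarrow> vector_field A Y \<longrightarrow>
      lie_derivative (a *\<^sub>R e1 + b *\<^sub>R e2 + c *\<^sub>R e3) T X Y = 0) \<longleftrightarrow>
    \<alpha> * \<beta> * \<gamma> * a = 0 \<and> \<alpha> * \<beta> * \<gamma> * b = 0"
proof -
  define \<xi> where "\<xi> = a *\<^sub>R e1 + b *\<^sub>R e2 + c *\<^sub>R e3"
  have \<xi>: "vector_field A \<xi>"
    by (simp add: \<xi>_def)
  have const: "vf_apply \<xi> (\<lambda>p. k) = 0" for k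
    using tvec_const[OF vf_tangent[OF \<xi>]] by (simp add: vf_apply_def fun_eq_iff)
  have br: "vf_bracket \<xi> e1 = (c * \<beta>) *\<^sub>R e2 + (b * \<gamma>) *\<^sub>R e3"
    "vf_bracket \<xi> e2 = (- c * \<alpha>) *\<^sub>R e1 + (- a * \<gamma>) *\<^sub>R e3"
    "vf_bracket \<xi> e3 = (b * \<alpha>) *\<^sub>R e1 + (- a * \<beta>) *\<^sub>R e2"
    unfolding \<xi>_def by (rule frame_bracket_combination)+
  have tens: "tensor02 (lie_derivative \<xi> T)"
    by (rule tensor02_lie_derivative[OF T \<xi> vector_field_bracket[OF \<xi>]])
  have lin: "T (x *\<^sub>R U + y *\<^sub>R V) W = x *\<^sub>R T U W + y *\<^sub>R T V W"
    "T W (x *\<^sub>R U + y *\<^sub>R V) = x *\<^sub>R T W U + y *\<^sub>R T W V"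
    if "vector_field A U" "vector_field A V" "vector_field A W" for x y U V W
    using that by (simp_all add: tensor02D(2,3,6,7)[OF T])
  note L = lie_derivative_def br lin Te const
  \<comment> \<open>In the \<open>(e1, e2)\<close> component the brackets with \<open>e1\<close> and
    \<open>e2\<close> contribute \<open>\<alpha> * \<beta> * \<gamma> * c\<close> with opposite
    signs, so \<open>c\<close> stays free.\<close>
  have zero: "lie_derivative \<xi> T e1 e1 = 0" "lie_derivative \<xi> T e2 e2 = 0" "lie_derivative \<xi> T e3 e3 = 0"
      "lie_derivative \<xi> T e1 e2 = 0" "lie_derivative \<xi> T e2 e1 = 0"
    by (simp_all only: L vf, simp_all add: fun_eq_iff)
  have e13: "lie_derivative \<xi> T e1 e3 = (\<lambda>p. \<alpha> * \<beta> * \<gamma> * b)"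
      "lie_derivative \<xi> T e3 e1 = (\<lambda>p. \<alpha> * \<beta> * \<gamma> * b)"
    by (simp_all only: L vf, simp_all add: fun_eq_iff)
  have e23: "lie_derivative \<xi> T e2 e3 = (\<lambda>p. - (\<alpha> * \<beta> * \<gamma> * a))"
      "lie_derivative \<xi> T e3 e2 = (\<lambda>p. - (\<alpha> * \<beta> * \<gamma> * a))"
    by (simp_all only: L vf, simp_all add: fun_eq_iff)
  show ?thesis
    unfolding \<xi>_def[symmetric]
  proof
    assume *: "\<forall>X Y. vector_field A X \<longrightarrow> vector_field A Y \<longrightarrow> lie_derivative \<xi> T X Y = 0"
    have "lie_derivative \<xi> T e1 e3 = 0" "lie_derivative \<xi> T e2 e3 = 0"
      using * by simp_all
    then show "\<alpha> * \<beta> * \<gamma> * a = 0 \<and> \<alpha> * \<beta> * \<gamma> * b = 0"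
      by (simp only: e13 e23) (simp add: fun_eq_iff)
  next
    assume *: "\<alpha> * \<beta> * \<gamma> * a = 0 \<and> \<alpha> * \<beta> * \<gamma> * b = 0"
    have "lie_derivative \<xi> T e1 e3 = 0" "lie_derivative \<xi> T e3 e1 = 0"
      "lie_derivative \<xi> T e2 e3 = 0" "lie_derivative \<xi> T e3 e2 = 0"
      using * by (simp_all only: e13 e23, simp_all only: zero_fun_def minus_zero)
    with zero show "\<forall>X Y. vector_field A X \<longrightarrow> vector_field A Y \<longrightarrow> lie_derivative \<xi> T X Y = 0"
      by (intro allI impI) (rule tensor02_zero_on_frame[OF tens])
  qed
qed

end

section \<open>Determination of the collineation space\<close>

lemma span_three:
  "x \<in> span {u, v, w} \<longleftrightarrow> (\<exists>a b c. x = a *\<^sub>R u + b *\<^sub>R v + c *\<^sub>R w)"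
proof -
  have "x - a *\<^sub>R u - b *\<^sub>R v = c *\<^sub>R w \<longleftrightarrow> x = a *\<^sub>R u + b *\<^sub>R v + c *\<^sub>R w" for a b c
    by (auto simp: algebra_simps)
  then show ?thesis
    by (simp add: span_breakdown_eq[of _ u] span_breakdown_eq[of _ v] span_singleton image_iff)
qed

text \<open>The two cases are exhaustive, so the equivalence amounts to the existence of a nonzero
  collineation; \<open>e3\<close> is one in both cases.\<close>

theorem theorem3p23:
  fixes mul :: "'g::{t2_space, second_countable_topology} \<Rightarrow> 'g \<Rightarrow> 'g"
    and one :: 'g and invs :: "'g \<Rightarrow> 'g"
    and A :: "('g, 3) chart set"
    and g :: "'g bilinear_field" and J :: "'g tensor11" and nabla :: "'g connection"
    and e1 e2 e3 :: "'g vfield"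
    and \<alpha> \<beta> \<gamma> :: real
  assumes "lie_group mul one invs A"
    and "connected (UNIV :: 'g set)"
    and "unimodular mul"
    and "lorentzian_metric A g" and "left_invariant_metric mul A g"
    and "distinct [e1, e2, e3]" and "independent {e1, e2, e3}"
    and "span {e1, e2, e3} = lie_algebra mul A"
    and "pseudo_orthonormal g e1 e2 e3"
    and "vf_bracket e1 e2 = (- \<gamma>) *\<^sub>R e3"
    and "vf_bracket e1 e3 = (- \<beta>) *\<^sub>R e2"
    and "vf_bracket e2 e3 = \<alpha> *\<^sub>R e1"
    and "product_structure A J" and "left_invariant_tensor11 mul A J"
    and "tensor_vf J e1 = e1" and "tensor_vf J e2 = e2" and "tensor_vf J e3 = - e3"
    and "levi_civita A g nabla"
  defines "V_RC \<equiv> ricci_collineations mul A g e1 e2 e3 (kobayashi_nomizu nabla J)"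
  shows "((\<exists>\<xi>\<in>V_RC. \<xi> \<noteq> 0) \<longleftrightarrow> \<alpha> * \<beta> * \<gamma> = 0 \<or> \<alpha> * \<beta> * \<gamma> \<noteq> 0) \<and>
    (\<alpha> * \<beta> * \<gamma> = 0 \<longrightarrow> V_RC = span {e1, e2, e3}) \<and>
    (\<alpha> * \<beta> * \<gamma> \<noteq> 0 \<longrightarrow> V_RC = span {e3})"
proof -
  have group: "smooth_atlas A"
    using assms(1) by (simp add: lie_group_def)
  have vf: "vector_field A e1" "vector_field A e2" "vector_field A e3"
    using span_superset[of "{e1, e2, e3}"] assms(8) by (auto simp: lie_algebra_def)
  interpret unimodular_lorentz_frame A g e1 e2 e3 \<alpha> \<beta> \<gamma>
    by unfold_locales (use group vf assms in auto)
  define D where "D = kobayashi_nomizu nabla J"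
  have affine: "affine_connection A D"
    unfolding D_def using affine_connection_kobayashi_nomizu[OF assms(13)] assms(18)
    by (simp add: levi_civita_def)
  define T where "T = ricci_sym g e1 e2 e3 D"
  note Te = ricci_sym_frame[OF affine
    kobayashi_nomizu_frame[OF assms(18,13,15-17), folded D_def], folded T_def]
  note crit = lie_derivative_diagonal[OF tensor02_ricci_sym[OF affine, folded T_def] Te]
  have alg: "\<xi> \<in> lie_algebra mul A \<longleftrightarrow> (\<exists>a b c. \<xi> = a *\<^sub>R e1 + b *\<^sub>R e2 + c *\<^sub>R e3)" for \<xi>
    unfolding assms(8)[symmetric] by (rule span_three)
  \<comment> \<open>Left-invariant fields have constant coefficients in the frame, so the
    collineation equation becomes a linear system in \<open>a, b, c\<close>.\<close>
  have V: "\<xi> \<in> V_RC \<longleftrightarrow> (\<exists>a b c. \<xi> = a *\<^sub>R e1 + b *\<^sub>R e2 + c *\<^sub>R e3 \<and>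
      \<alpha> * \<beta> * \<gamma> * a = 0 \<and> \<alpha> * \<beta> * \<gamma> * b = 0)" for \<xi>
  proof -
    have "\<xi> \<in> V_RC \<longleftrightarrow> (\<exists>a b c. \<xi> = a *\<^sub>R e1 + b *\<^sub>R e2 + c *\<^sub>R e3 \<and>
      (\<forall>X Y. vector_field A X \<longrightarrow> vector_field A Y \<longrightarrow>
        lie_derivative (a *\<^sub>R e1 + b *\<^sub>R e2 + c *\<^sub>R e3) T X Y = 0))"
      unfolding V_RC_def ricci_collineations_def mem_Collect_eq alg D_def[symmetric] T_def[symmetric]
      by blast
    then show ?thesis
      unfolding crit .
  qed
  \<comment> \<open>With \<open>a = b = 0\<close> the system holds whatever
    \<open>\<alpha>, \<beta>, \<gamma>\<close> are.\<close>
  have "e3 = 0 *\<^sub>R e1 + 0 *\<^sub>R e2 + 1 *\<^sub>R e3"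
    by simp
  then have "e3 \<in> V_RC"
    unfolding V by (metis mult_zero_right)
  moreover have "e3 \<noteq> 0"
  proof
    assume "e3 = 0"
    then have "0 \<in> {e1, e2, e3}" by simp
    then have "dependent {e1, e2, e3}" by (rule dependent_zero)
    with assms(7) show False by (rule notE)
  qed
  ultimately have nonzero: "\<exists>\<xi>\<in>V_RC. \<xi> \<noteq> 0" by (intro bexI[of _ e3])
  have degenerate: "V_RC = span {e1, e2, e3}" if "\<alpha> * \<beta> * \<gamma> = 0"
    unfolding set_eq_iff V assms(8) alg that by simp
  have generic: "V_RC = span {e3}" if "\<alpha> * \<beta> * \<gamma> \<noteq> 0"
  proof -
    \<comment> \<open>Cancelling the nonzero product forces \<open>a = b = 0\<close>, leaving the
      multiples of \<open>e3\<close>.\<close>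
    have "\<alpha> * \<beta> * \<gamma> * a = 0 \<longleftrightarrow> a = 0" for a
      using that by simp
    then show ?thesis
      unfolding set_eq_iff V span_singleton image_iff by simp
  qed
  have "(\<exists>\<xi>\<in>V_RC. \<xi> \<noteq> 0) \<longleftrightarrow> \<alpha> * \<beta> * \<gamma> = 0 \<or> \<alpha> * \<beta> * \<gamma> \<noteq> 0"
    using nonzero by blast
  with degenerate generic show ?thesis
    by (intro conjI impI)
qed

end
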